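(* Let $G$ be an $h\times n$ grid graph with $h\le n$. (a) If $h=2$, there is a polynomial-time algorithm which, given any initial configuration $C$ on $G$, finds a solution of the parallel token swapping problem $(G,C)$ with value at most $2\,OPT+2$. (b) If $h\ge 3$, there is a polynomial-time algorithm which, given any initial configuration $C$ on $G$, finds a solution of the parallel token swapping problem $(G,C)$ with value at most $2\,OPT+2h$. Here $OPT=OPT(G,C)$ is the optimal solution value of the given instance.
   Context: Let $G=(V,E)$ be a finite connected undirected simple graph. The token set $T$ is a copy of $V$. A configuration is a bijection $C:V\to T$ ($C(v)$ is the token lying on vertex $v$); $Id$ is the canonical identity bijection. A matching $M\subseteq E$ routes a configuration $C$ to the configuration $MC$ given by $MC(v)=C(w)$ if $(v,w)\in M$, and $MC(v)=C(v)$ if $v$ is not covered by $M$. The parallel token swapping problem: given $(G,C)$, a solution is a sequence of matchings $(M_1,\ldots,M_k)$ of $G$ such that $M_k\cdots M_1C=Id$; its value (size) is $k$, and $OPT(G,C)$ is the minimum value of a solution. The $h\times n$ grid graph has vertex set $\{(a,b):1\le a\le h,\ 1\le b\le n\}$ and edge set $\{((a,b),(a+1,b)):1\le a\le h-1,\ 1\le b\le n\}\cup\{((a,b),(a,b+1)):1\le a\le h,\ 1\le b\le n-1\}$. *)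

theory Defs
  imports "HOL-Computational_Algebra.Polynomial"
begin

section \<open>Parallel token swapping\<close>

text \<open>A graph is a pair of a vertex set and a set of two-element edges.  The token set is
  identified with the vertex set, so that the identity configuration is \<open>\<lambda>v. v\<close>.\<close>

type_synonym 'a graph = "'a set \<times> 'a set set"

abbreviation verts :: "'a graph \<Rightarrow> 'a set" where "verts \<equiv> fst"
abbreviation edges :: "'a graph \<Rightarrow> 'a set set" where "edges \<equiv> snd"

definition configuration :: "'a graph \<Rightarrow> ('a \<Rightarrow> 'a) \<Rightarrow> bool" where
  "configuration G C \<longleftrightarrow> bij_betw C (verts G) (verts G)"

definition matching :: "'a graph \<Rightarrow> 'a set set \<Rightarrow> bool" where
  "matching G M \<longleftrightarrow> M \<subseteq> edges G \<and> (\<forall>e\<in>M. \<forall>e'\<in>M. e \<noteq> e' \<longrightarrow> e \<inter> e' = {})"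

definition apply_matching :: "'a set set \<Rightarrow> ('a \<Rightarrow> 'b) \<Rightarrow> 'a \<Rightarrow> 'b" where
  "apply_matching M C v = (if \<exists>w. {v, w} \<in> M then C (THE w. {v, w} \<in> M) else C v)"

text \<open>\<open>fold\<close> applies the matchings of the list from left to right.\<close>

definition solution :: "'a graph \<Rightarrow> ('a \<Rightarrow> 'a) \<Rightarrow> 'a set set list \<Rightarrow> bool" where
  "solution G C Ms \<longleftrightarrow>
     (\<forall>M\<in>set Ms. matching G M) \<and> (\<forall>v\<in>verts G. fold apply_matching Ms C v = v)"

text \<open>The minimum exists for every configuration of a finite connected graph.\<close>

definition OPT :: "'a graph \<Rightarrow> ('a \<Rightarrow> 'a) \<Rightarrow> nat" where
  "OPT G C = (LEAST k. \<exists>Ms. solution G C Ms \<and> length Ms = k)"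

definition grid :: "nat \<Rightarrow> nat \<Rightarrow> (nat \<times> nat) graph" where
  "grid h n =
     ({(a, b). 1 \<le> a \<and> a \<le> h \<and> 1 \<le> b \<and> b \<le> n},
      {{(a, b), (a + 1, b)} | a b. 1 \<le> a \<and> a \<le> h - 1 \<and> 1 \<le> b \<and> b \<le> n} \<union>
      {{(a, b), (a, b + 1)} | a b. 1 \<le> a \<and> a \<le> h \<and> 1 \<le> b \<and> b \<le> n - 1})"

section \<open>Polynomial-time algorithms\<close>

text \<open>Algorithms are programs of a random access machine with structured control flow.  The
  memory consists of one infinite array of natural numbers per name (a program can only use
  finitely many of them).  Each executed operation costs one unit.  The arithmetic operations are
  addition and truncated subtraction only: with these, a number grows by at most a constant number
  of bits per unit of time, hence the machine is polynomially equivalent to Turing machines.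
  Unit-cost multiplication would destroy this equivalence.\<close>

type_synonym name = string
type_synonym state = "name \<Rightarrow> nat \<Rightarrow> nat"

datatype aexp = Lit nat | Read name aexp | Plus aexp aexp | Minus aexp aexp

datatype bexp = Less aexp aexp | Equal aexp aexp | Neg bexp | Conj bexp bexp

datatype com =
    Skip
  | Write name aexp aexp
  | Seq com com
  | Cond bexp com com
  | While bexp com

fun aval :: "aexp \<Rightarrow> state \<Rightarrow> nat" where
  "aval (Lit k) s = k"
| "aval (Read x e) s = s x (aval e s)"
| "aval (Plus e1 e2) s = aval e1 s + aval e2 s"
| "aval (Minus e1 e2) s = aval e1 s - aval e2 s"

fun bval :: "bexp \<Rightarrow> state \<Rightarrow> bool" where
  "bval (Less e1 e2) s \<longleftrightarrow> aval e1 s < aval e2 s"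
| "bval (Equal e1 e2) s \<longleftrightarrow> aval e1 s = aval e2 s"
| "bval (Neg b) s \<longleftrightarrow> \<not> bval b s"
| "bval (Conj b1 b2) s \<longleftrightarrow> bval b1 s \<and> bval b2 s"

fun acost :: "aexp \<Rightarrow> nat" where
  "acost (Lit k) = 1"
| "acost (Read x e) = 1 + acost e"
| "acost (Plus e1 e2) = 1 + acost e1 + acost e2"
| "acost (Minus e1 e2) = 1 + acost e1 + acost e2"

fun bcost :: "bexp \<Rightarrow> nat" where
  "bcost (Less e1 e2) = 1 + acost e1 + acost e2"
| "bcost (Equal e1 e2) = 1 + acost e1 + acost e2"
| "bcost (Neg b) = 1 + bcost b"
| "bcost (Conj b1 b2) = 1 + bcost b1 + bcost b2"

text \<open>\<open>exec c s t s'\<close>: started in state \<open>s\<close>, the program \<open>c\<close> halts in state \<open>s'\<close> after \<open>t\<close> units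
  of time.\<close>

inductive exec :: "com \<Rightarrow> state \<Rightarrow> nat \<Rightarrow> state \<Rightarrow> bool" where
  Skip: "exec Skip s 1 s"
| Write: "exec (Write x i e) s (1 + acost i + acost e) (s(x := (s x)(aval i s := aval e s)))"
| Seq: "exec c1 s1 t1 s2 \<Longrightarrow> exec c2 s2 t2 s3 \<Longrightarrow> exec (Seq c1 c2) s1 (t1 + t2) s3"
| CondTrue: "bval b s \<Longrightarrow> exec c1 s t s' \<Longrightarrow> exec (Cond b c1 c2) s (1 + bcost b + t) s'"
| CondFalse: "\<not> bval b s \<Longrightarrow> exec c2 s t s' \<Longrightarrow> exec (Cond b c1 c2) s (1 + bcost b + t) s'"
| WhileFalse: "\<not> bval b s \<Longrightarrow> exec (While b c) s (1 + bcost b) s"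
| WhileTrue: "bval b s1 \<Longrightarrow> exec c s1 t1 s2 \<Longrightarrow> exec (While b c) s2 t2 s3 \<Longrightarrow>
    exec (While b c) s1 (1 + bcost b + t1 + t2) s3"

lemma exec_deterministic:
  "exec c s t s' \<Longrightarrow> exec c s u s'' \<Longrightarrow> t = u \<and> s' = s''"
proof (induction arbitrary: u s'' rule: exec.induct)
  case (Skip s)
  then show ?case by (cases rule: exec.cases) simp_all
next
  case (Write x i e s)
  then show ?case by (cases rule: exec.cases) simp_all
next
  case (Seq c1 s1 t1 s2 c2 t2 s3)
  from Seq.prems show ?case
    by (cases rule: exec.cases) (use Seq.IH in blast)+
next
  case (CondTrue b s c1 t s' c2)
  from CondTrue.prems show ?case
    by (cases rule: exec.cases) (use CondTrue.hyps CondTrue.IH in blast)+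
next
  case (CondFalse b s c2 t s' c1)
  from CondFalse.prems show ?case
    by (cases rule: exec.cases) (use CondFalse.hyps CondFalse.IH in blast)+
next
  case (WhileFalse b s c)
  from WhileFalse.prems show ?case
    by (cases rule: exec.cases) (use WhileFalse.hyps in blast)+
next
  case (WhileTrue b s1 c t1 s2 t2 s3)
  from WhileTrue.prems show ?case
    by (cases rule: exec.cases) (use WhileTrue.hyps WhileTrue.IH in blast)+
qed

text \<open>Inputs and outputs are lists of numbers.  All cells not mentioned here are initially 0.\<close>

definition input_state :: "nat list \<Rightarrow> state" where
  "input_state xs x i =
     (if x = ''in'' \<and> i < length xs then xs ! i
      else if x = ''inlen'' \<and> i = 0 then length xs
      else 0)"

definition output_of :: "state \<Rightarrow> nat list" where
  "output_of s = map (s ''out'') [0..<s ''outlen'' 0]"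

definition outputs :: "com \<Rightarrow> nat list \<Rightarrow> nat list \<Rightarrow> bool" where
  "outputs A xs ys \<longleftrightarrow> (\<exists>t s. exec A (input_state xs) t s \<and> output_of s = ys)"

text \<open>The time is measured in the length of the input list, which is at most its bit length.\<close>

definition poly_time_on :: "nat list set \<Rightarrow> com \<Rightarrow> bool" where
  "poly_time_on X A \<longleftrightarrow>
     (\<exists>p :: nat poly. \<forall>xs\<in>X. \<exists>t s. exec A (input_state xs) t s \<and> t \<le> poly p (length xs))"

section \<open>Encoding of instances and solutions on grids\<close>

text \<open>A map from grid vertices to grid vertices is encoded by the list of its values in row-major
  order.\<close>

definition encode_map :: "nat \<Rightarrow> nat \<Rightarrow> (nat \<times> nat \<Rightarrow> nat \<times> nat) \<Rightarrow> nat list" where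
  "encode_map h n f =
     concat (map (\<lambda>v. [fst (f v), snd (f v)]) (List.product [1..<h + 1] [1..<n + 1]))"

definition encode_instance :: "nat \<Rightarrow> nat \<Rightarrow> (nat \<times> nat \<Rightarrow> nat \<times> nat) \<Rightarrow> nat list" where
  "encode_instance h n C = [h, n] @ encode_map h n C"

text \<open>A matching \<open>M\<close> is encoded by its partner table: \<open>apply_matching M (\<lambda>v. v)\<close> maps each vertex
  covered by \<open>M\<close> to its partner and each other vertex to itself.  A sequence of matchings is
  encoded by the concatenation of the tables, which all have the same length \<open>2 * h * n\<close>.\<close>

definition encode_solution :: "nat \<Rightarrow> nat \<Rightarrow> (nat \<times> nat) set set list \<Rightarrow> nat list" where
  "encode_solution h n Ms = concat (map (\<lambda>M. encode_map h n (apply_matching M (\<lambda>v. v))) Ms)"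

end

theory Submission
  imports Defs
begin

text \<open>Sort the columns, then the rows by target column, then the columns by target row, each time with
  odd-even transposition sort on all lines in parallel.  The first sorting makes the tokens of every
  row have distinct target columns; its keys come from a proper edge colouring of the \<open>h\<close>-regular
  bipartite multigraph whose edges join the current to the target column of each token.  Each column
  phase takes \<open>h\<close> rounds (one round if \<open>h = 2\<close>).  A token is never more than \<open>D\<close> columns away
  from its target when the row phase starts, where \<open>D\<close> is the largest column displacement in \<open>C\<close>;
  odd-even transposition then needs only \<open>2 * D\<close> rounds, and \<open>D \<le> OPT\<close> because a matching moves a token
  by at most one column.

  The colouring is found by local search: if colour \<open>r\<close> occurs at target column \<open>j\<close> at least two times more
  than colour \<open>s\<close>, exchange the two colours along a greedy trail from \<open>j\<close>.  This decreases
  the sum of the squared colour multiplicities.\<close>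

section \<open>Total correctness with running times\<close>

text \<open>The bound of \<open>2 * D\<close> rounds rests on thresholds, as in the zero-one
  principle. Count the values at least \<open>z\<close> among the first \<open>i\<close> positions
  of a line. Displacement at most \<open>d\<close> bounds this count essentially by \<open>d\<close>
  and by \<open>i - z + d\<close>; the sum bounds twice the count by \<open>2 * d - z + i\<close>.
  Each round lowers this bound by one, up to a lag of one round, and at \<open>i = z\<close> it is
  used up after \<open>2 * d\<close> rounds. The trivial bounds \<open>m - z\<close> and
  \<open>i\<close> give \<open>m\<close> rounds in the same way.

  The local search yields existence and running time of the colouring at once. The multiplicities of
  the \<open>h\<close> colours at a target column sum to \<open>h\<close>, so if any two differ by
  at most one, all are 1. Exchanging two colours in a single column removes a surplus at
  \<open>j\<close> but may create one at the other end of that arc; hence the exchange continues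
  from there. No column is used twice, so a trail ends after at most \<open>n\<close> steps. Inner
  points of the trail keep their multiplicities, and at its end the stopping condition prevents a
  growth of the squares.\<close>

fun writes :: "com \<Rightarrow> name set" where
  "writes Skip = {}"
| "writes (Write x i e) = {x}"
| "writes (Seq c1 c2) = writes c1 \<union> writes c2"
| "writes (Cond b c1 c2) = writes c1 \<union> writes c2"
| "writes (While b c) = writes c"

lemma exec_frame: "exec c s t s' \<Longrightarrow> x \<notin> writes c \<Longrightarrow> s' x = s x"
  by (induction rule: exec.induct) auto

text \<open>Upper bound on the running time of \<open>c\<close> if every execution of a loop in \<open>c\<close> makes at most \<open>B\<close> iterations.\<close>

fun time_bound :: "nat \<Rightarrow> com \<Rightarrow> nat" where
  "time_bound B Skip = 1"
| "time_bound B (Write x i e) = 1 + acost i + acost e"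
| "time_bound B (Seq c1 c2) = time_bound B c1 + time_bound B c2"
| "time_bound B (Cond b c1 c2) = 1 + bcost b + time_bound B c1 + time_bound B c2"
| "time_bound B (While b c) = 1 + bcost b + B * (1 + bcost b + time_bound B c)"

text \<open>The program is fixed, so the nesting depth of its loops only affects the degree: one
  polynomial \<open>q\<close> for all iteration counts gives a polynomial running time.\<close>

lemma time_bound_poly: "\<exists>p :: nat poly. \<forall>l. time_bound (poly q l) c = poly p l"
proof (induction c)
  case Skip
  show ?case by (rule exI[of _ "[:1:]"]) simp
next
  case (Write x i e)
  show ?case by (rule exI[of _ "[:1 + acost i + acost e:]"]) simp
next
  case (Seq c1 c2)
  then obtain p1 p2 where "\<forall>l. time_bound (poly q l) c1 = poly p1 l"
    "\<forall>l. time_bound (poly q l) c2 = poly p2 l" by blast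
  then show ?case by (intro exI[of _ "p1 + p2"]) simp
next
  case (Cond b c1 c2)
  then obtain p1 p2 where "\<forall>l. time_bound (poly q l) c1 = poly p1 l"
    "\<forall>l. time_bound (poly q l) c2 = poly p2 l" by blast
  then show ?case by (intro exI[of _ "[:1 + bcost b:] + p1 + p2"]) simp
next
  case (While b c)
  then obtain p where "\<forall>l. time_bound (poly q l) c = poly p l" by blast
  then show ?case by (intro exI[of _ "[:1 + bcost b:] + q * ([:1 + bcost b:] + p)"]) simp
qed

text \<open>Time stays out of the postcondition: the syntactic bound composes along the program, and
  a proof only has to keep each loop within \<open>B\<close> iterations.\<close>

definition wp :: "nat \<Rightarrow> com \<Rightarrow> (state \<Rightarrow> bool) \<Rightarrow> state \<Rightarrow> bool" where
  "wp B c Q s \<longleftrightarrow> (\<exists>t s'. exec c s t s' \<and> t \<le> time_bound B c \<and> Q s')"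

text \<open>Specifications can thus be limited to the arrays that matter; everything that is never
  assigned is recovered from the syntax.\<close>

lemma wp_frame:
  assumes "wp B c Q s"
    and "\<And>s'. Q s' \<Longrightarrow> (\<And>x. x \<notin> writes c \<Longrightarrow> s' x = s x) \<Longrightarrow> Q' s'"
  shows "wp B c Q' s"
proof -
  obtain t s' where 1: "exec c s t s'" "t \<le> time_bound B c" "Q s'"
    using assms(1) unfolding wp_def by blast
  have "Q' s'" using assms(2)[OF 1(3)] exec_frame[OF 1(1)] by blast
  with 1 show ?thesis unfolding wp_def by blast
qed

lemma wp_Skip: "Q s \<Longrightarrow> wp B Skip Q s"
  unfolding wp_def using exec.Skip[of s] by force

lemma wp_Write: "Q (s(x := (s x)(aval i s := aval e s))) \<Longrightarrow> wp B (Write x i e) Q s"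
  unfolding wp_def using exec.Write[of x i e s] by force

lemma wp_Seq: "wp B c1 (wp B c2 Q) s \<Longrightarrow> wp B (Seq c1 c2) Q s"
  unfolding wp_def by (fastforce intro: exec.Seq add_mono)

lemma wp_SeqI:
  assumes "wp B c1 P s"
    and "\<And>s'. P s' \<Longrightarrow> (\<And>x. x \<notin> writes c1 \<Longrightarrow> s' x = s x) \<Longrightarrow> wp B c2 Q s'"
  shows "wp B (Seq c1 c2) Q s"
  by (rule wp_Seq, rule wp_frame[OF assms])

lemma wp_Cond:
  assumes "bval b s \<Longrightarrow> wp B c1 Q s" "\<not> bval b s \<Longrightarrow> wp B c2 Q s"
  shows "wp B (Cond b c1 c2) Q s"
proof (cases "bval b s")
  case True
  then obtain t s' where "exec c1 s t s'" "t \<le> time_bound B c1" "Q s'"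
    using assms(1) unfolding wp_def by blast
  then have "exec (Cond b c1 c2) s (1 + bcost b + t) s'"
    "1 + bcost b + t \<le> time_bound B (Cond b c1 c2)"
    using exec.CondTrue True by auto
  with \<open>Q s'\<close> show ?thesis unfolding wp_def by blast
next
  case False
  then obtain t s' where "exec c2 s t s'" "t \<le> time_bound B c2" "Q s'"
    using assms(2) unfolding wp_def by blast
  then have "exec (Cond b c1 c2) s (1 + bcost b + t) s'"
    "1 + bcost b + t \<le> time_bound B (Cond b c1 c2)"
    using exec.CondFalse False by auto
  with \<open>Q s'\<close> show ?thesis unfolding wp_def by blast
qed

text \<open>The measure proves termination and counts iterations. In both frame premises
  \<open>s\<close> is the state before the loop, so \<open>I\<close> need not repeat facts about
  unassigned arrays.\<close>

lemma wp_While: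
  fixes m :: "state \<Rightarrow> nat"
  assumes "I s" "m s \<le> B"
    and step: "\<And>s'. \<lbrakk>I s'; bval b s'; \<And>x. x \<notin> writes c \<Longrightarrow> s' x = s x\<rbrakk> \<Longrightarrow>
      wp B c (\<lambda>s''. I s'' \<and> m s'' < m s') s'"
    and post: "\<And>s'. \<lbrakk>I s'; \<not> bval b s'; \<And>x. x \<notin> writes c \<Longrightarrow> s' x = s x\<rbrakk> \<Longrightarrow> Q s'"
  shows "wp B (While b c) Q s"
proof -
  let ?k = "1 + bcost b + time_bound B c"
  \<comment> \<open>The current measure takes the place of \<open>B\<close>, so that the induction
    can spend one unit per iteration.\<close>
  have "\<exists>t s''. exec (While b c) s' t s'' \<and> t \<le> 1 + bcost b + m s' * ?k \<and> Q s''"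
    if "I s'" "\<And>x. x \<notin> writes c \<Longrightarrow> s' x = s x" for s'
    using that
  proof (induction "m s'" arbitrary: s' rule: less_induct)
    case less
    show ?case
    proof (cases "bval b s'")
      case False
      then show ?thesis
        using exec.WhileFalse[of b s' c] post[OF less.prems(1) False less.prems(2)]
        by (meson le_add1)
    next
      case True
      from step[OF less.prems(1) True less.prems(2)]
      obtain t1 s1 where 1: "exec c s' t1 s1" "t1 \<le> time_bound B c" "I s1" "m s1 < m s'"
        unfolding wp_def by blast
      have "\<And>x. x \<notin> writes c \<Longrightarrow> s1 x = s x"
        using exec_frame[OF 1(1)] less.prems(2) by simp
      from less.hyps[OF 1(4,3) this] obtain t2 s2
        where 2: "exec (While b c) s1 t2 s2" "t2 \<le> 1 + bcost b + m s1 * ?k" "Q s2"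
        by blast
      have "Suc (m s1) * ?k \<le> m s' * ?k"
        using 1(4) by (intro mult_right_mono) simp_all
      then have "1 + bcost b + t1 + t2 \<le> 1 + bcost b + m s' * ?k"
        using 1(2) 2(2) by simp
      with exec.WhileTrue[OF True 1(1) 2(1)] 2(3) show ?thesis by blast
    qed
  qed
  from this[of s] assms(1) obtain t s''
    where "exec (While b c) s t s''" "t \<le> 1 + bcost b + m s * ?k" "Q s''" by blast
  moreover have "m s * ?k \<le> B * ?k" using assms(2) by (rule mult_right_mono) simp
  then have "1 + bcost b + m s * ?k \<le> time_bound B (While b c)" by simp
  ultimately show ?thesis unfolding wp_def by (meson order_trans)
qed

abbreviation Var :: "name \<Rightarrow> aexp" where "Var x \<equiv> Read x (Lit 0)"
abbreviation Set :: "name \<Rightarrow> aexp \<Rightarrow> com" where "Set x e \<equiv> Write x (Lit 0) e"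

definition For :: "name \<Rightarrow> name \<Rightarrow> com \<Rightarrow> com" where
  "For i x c = Seq (Set i (Lit 0)) (While (Less (Var i) (Var x)) (Seq c (Set i (Plus (Var i) (Lit 1)))))"

lemma writes_For [simp]: "writes (For i x c) = insert i (writes c)"
  by (auto simp: For_def)

text \<open>The invariant sees the counter only through its parameter \<open>k\<close>. It must
  survive the reset before the loop and the increment behind the body, which is what
  \<open>indep\<close> provides.\<close>

lemma wp_For:
  assumes init: "I 0 s" and bnd: "s x 0 \<le> B"
    and fresh: "x \<noteq> i" "x \<notin> writes c" "i \<notin> writes c"
    and indep: "\<And>k s' v. I k s' \<Longrightarrow> I k (s'(i := v))"
    and body: "\<And>k s'. \<lbrakk>I k s'; k < s x 0; s' i 0 = k;
      \<And>y. y \<noteq> i \<Longrightarrow> y \<notin> writes c \<Longrightarrow> s' y = s y\<rbrakk> \<Longrightarrow> wp B c (I (Suc k)) s'"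
    and post: "\<And>s'. \<lbrakk>I (s x 0) s'; \<And>y. y \<noteq> i \<Longrightarrow> y \<notin> writes c \<Longrightarrow> s' y = s y\<rbrakk> \<Longrightarrow> Q s'"
  shows "wp B (For i x c) Q s"
  unfolding For_def
proof (intro wp_Seq wp_Write, rule wp_While)
  let ?s = "s(i := (s i)(aval (Lit 0) s := aval (Lit 0) s))"
  let ?I = "\<lambda>s'. s' i 0 \<le> s x 0 \<and> I (s' i 0) s'"
  show "?I ?s" using indep[OF init] by simp
  show "(\<lambda>s'. s x 0 - s' i 0) ?s \<le> B" using bnd by simp
next
  let ?s = "s(i := (s i)(aval (Lit 0) s := aval (Lit 0) s))"
  let ?I = "\<lambda>s'. s' i 0 \<le> s x 0 \<and> I (s' i 0) s'"
  fix s'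
  assume I: "?I s'" and b: "bval (Less (Var i) (Var x)) s'"
    and fr: "\<And>y. y \<notin> writes (Seq c (Set i (Plus (Var i) (Lit 1)))) \<Longrightarrow> s' y = ?s y"
  have fr': "s' y = s y" if "y \<noteq> i" "y \<notin> writes c" for y using fr[of y] that by simp
  have lt: "s' i 0 < s x 0" using b fr'[of x] fresh by simp
  show "wp B (Seq c (Set i (Plus (Var i) (Lit 1))))
    (\<lambda>s''. ?I s'' \<and> s x 0 - s'' i 0 < s x 0 - s' i 0) s'"
  proof (rule wp_Seq, rule wp_frame[OF body[OF conjunct2[OF I] lt refl fr']])
    fix s''
    assume I': "I (Suc (s' i 0)) s''" and "\<And>x. x \<notin> writes c \<Longrightarrow> s'' x = s' x"
    then have "s'' i 0 = s' i 0" using fresh(3) by simp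
    with lt indep[OF I']
    show "wp B (Set i (Plus (Var i) (Lit 1))) (\<lambda>s''. ?I s'' \<and> s x 0 - s'' i 0 < s x 0 - s' i 0) s''"
      by (intro wp_Write) (auto)
  qed simp_all
next
  let ?s = "s(i := (s i)(aval (Lit 0) s := aval (Lit 0) s))"
  fix s'
  assume I: "s' i 0 \<le> s x 0 \<and> I (s' i 0) s'" and b: "\<not> bval (Less (Var i) (Var x)) s'"
    and fr: "\<And>y. y \<notin> writes (Seq c (Set i (Plus (Var i) (Lit 1)))) \<Longrightarrow> s' y = ?s y"
  have fr': "s' y = s y" if "y \<noteq> i" "y \<notin> writes c" for y using fr[of y] that by simp
  have "s' i 0 = s x 0" using I b fr'[of x] fresh by simp
  then show "Q s'" using I fr' by (intro post) simp_all
qed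

section \<open>Odd-even transposition sort on a path\<close>

definition line_partner :: "nat \<Rightarrow> nat \<Rightarrow> (nat \<Rightarrow> nat) \<Rightarrow> nat \<Rightarrow> nat" where
  "line_partner m p f i =
     (if i mod 2 = p \<and> i + 1 < m \<and> f (i + 1) < f i then i + 1
      else if i mod 2 \<noteq> p \<and> 0 < i \<and> f i < f (i - 1) then i - 1
      else i)"

definition line_run :: "nat \<Rightarrow> (nat \<Rightarrow> nat \<Rightarrow> nat) \<Rightarrow> bool" where
  "line_run m F \<longleftrightarrow> (\<forall>t. \<forall>i<m. F (Suc t) i = F t (line_partner m (t mod 2) (F t) i))"

text \<open>The threshold \<open>z\<close> turns values into bits. Prefix counts are used instead of
  the bits because a round changes them by a simple recurrence.\<close>

definition ones :: "(nat \<Rightarrow> nat) \<Rightarrow> nat \<Rightarrow> nat \<Rightarrow> nat" where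
  "ones f z i = card {q. q < i \<and> z \<le> f q}"

lemma ones_0 [simp]: "ones f z 0 = 0"
  by (simp add: ones_def)

lemma ones_Suc: "ones f z (Suc i) = ones f z i + of_bool (z \<le> f i)"
proof -
  have "{q. q < Suc i \<and> z \<le> f q} =
    (if z \<le> f i then insert i {q. q < i \<and> z \<le> f q} else {q. q < i \<and> z \<le> f q})"
    by (auto simp: less_Suc_eq)
  then show ?thesis by (simp add: ones_def)
qed

lemma ones_le: "ones f z i \<le> i"
  by (induction i) (auto simp: ones_Suc)

lemma ones_top:
  assumes "inj_on f {..<m}" "\<forall>q<m. f q < m"
  shows "ones f z m \<le> m - z"
proof -
  have "card {q. q < m \<and> z \<le> f q} = card (f ` {q. q < m \<and> z \<le> f q})"
    by (rule card_image[symmetric]) (rule inj_on_subset[OF assms(1)], auto)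
  also have "\<dots> \<le> card {z..<m}"
    by (rule card_mono) (use assms in auto)
  finally show ?thesis by (simp add: ones_def)
qed

lemma line_partner_lt: "i < m \<Longrightarrow> line_partner m p f i < m"
  by (auto simp: line_partner_def)

text \<open>The pairs of one parity are disjoint, and both members of a pair test the same
  inequality. Hence a round is a permutation by disjoint transpositions.\<close>

lemma line_partner_idem:
  assumes "p < 2" "i < m"
  shows "line_partner m p f (line_partner m p f i) = i"
proof -
  have 1: "Suc i mod 2 \<noteq> p \<longleftrightarrow> i mod 2 = p" using assms(1) by presburger
  show ?thesis
  proof (cases i)
    case 0
    then show ?thesis using 1 assms by (simp add: line_partner_def)
  next
    case (Suc k)
    have "k mod 2 = p \<longleftrightarrow> i mod 2 \<noteq> p" using assms(1) Suc by presburger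
    then show ?thesis using 1 assms Suc
      by (cases "k = 0"; cases "p = 0") (auto simp: line_partner_def)
  qed
qed

lemma line_partner_inj: "p < 2 \<Longrightarrow> inj_on (line_partner m p f) {..<m}"
  by (rule inj_on_inverseI[where g = "line_partner m p f"]) (simp add: line_partner_idem)

lemma line_run_inj:
  assumes "line_run m F" "inj_on (F 0) {..<m}" "\<forall>q<m. F 0 q < m"
  shows "inj_on (F t) {..<m} \<and> (\<forall>q<m. F t q < m)"
proof (induction t)
  case 0
  then show ?case using assms by simp
next
  case (Suc t)
  let ?l = "line_partner m (t mod 2) (F t)"
  have eq: "F (Suc t) q = F t (?l q)" if "q < m" for q
    using assms(1) that by (simp add: line_run_def)
  have "inj_on (F t \<circ> ?l) {..<m}"
  proof (rule comp_inj_on)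
    show "inj_on ?l {..<m}" by (rule line_partner_inj) simp
    show "inj_on (F t) (?l ` {..<m})"
      by (rule inj_on_subset[of _ "{..<m}"]) (use Suc line_partner_lt in auto)
  qed
  then have "inj_on (F (Suc t)) {..<m}"
    by (subst inj_on_cong[of _ _ "F t \<circ> ?l"]) (simp_all add: eq)
  then show ?case using Suc eq line_partner_lt by simp
qed

text \<open>No compared pair straddles the cut before position \<open>i\<close>, so the round
  permutes the first \<open>i\<close> positions among themselves.\<close>

lemma ones_unchanged:
  assumes p: "p < 2" and g: "\<forall>i<m. g i = f (line_partner m p f i)"
    and "i \<le> m" "i mod 2 = p \<or> i = 0 \<or> i = m"
  shows "ones g z i = ones f z i"
proof -
  let ?l = "line_partner m p f"
  have lt: "?l q < i" if q: "q < i" for q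
  proof -
    have "i mod 2 = p \<Longrightarrow> q mod 2 = p \<Longrightarrow> Suc q \<noteq> i"
      by (auto simp: mod_Suc split: if_splits)
    then show ?thesis using q assms(4) by (auto simp: line_partner_def)
  qed
  have "bij_betw ?l {q. q < i \<and> z \<le> g q} {q. q < i \<and> z \<le> f q}"
  proof (rule bij_betw_byWitness[where f' = ?l])
    show "\<forall>a\<in>{q. q < i \<and> z \<le> g q}. ?l (?l a) = a"
      "\<forall>a\<in>{q. q < i \<and> z \<le> f q}. ?l (?l a) = a"
      using assms(3) p by (auto simp: line_partner_idem)
    show "?l ` {q. q < i \<and> z \<le> g q} \<subseteq> {q. q < i \<and> z \<le> f q}"
      using lt g assms(3) by auto
    have "g (?l q) = f q" if "q < i" for q
    proof -
      have "g (?l q) = f (?l (?l q))" using g lt[OF that] assms(3) by simp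
      then show ?thesis using that assms(3) p by (simp add: line_partner_idem)
    qed
    then show "?l ` {q. q < i \<and> z \<le> f q} \<subseteq> {q. q < i \<and> z \<le> g q}"
      using lt by auto
  qed
  then show ?thesis unfolding ones_def by (rule bij_betw_same_card)
qed

text \<open>The prefix counts of the thresholded sequence obey a max-plus recurrence.\<close>

lemma ones_changed:
  assumes p: "p < 2" and g: "\<forall>i<m. g i = f (line_partner m p f i)"
    and i: "0 < i" "i < m" "i mod 2 \<noteq> p"
  shows "ones g z i = max (ones f z (i - 1)) (ones f z (i + 1) - 1)"
proof -
  obtain k where k: "i = Suc k" using i(1) by (cases i) auto
  have kp: "k mod 2 = p" using i(3) p k by presburger
  have "ones g z k = ones f z k"
    by (rule ones_unchanged[OF p g]) (use i k kp in auto)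
  moreover have "g k = min (f k) (f (Suc k))"
    using g kp i k by (auto simp: line_partner_def)
  ultimately show ?thesis by (auto simp: k ones_Suc)
qed

text \<open>The positions \<open>i\<close> with \<open>i + t\<close> odd are those whose prefix count did not change in the latest
  round; their bound lags behind by one round.\<close>

lemma line_run_ones:
  assumes run: "line_run m F" and inj: "inj_on (F 0) {..<m}" and lt: "\<forall>q<m. F 0 q < m"
    and z: "z \<le> m"
    and init: "\<And>i. i \<le> m \<Longrightarrow>
      2 * int (ones (F 0) z i) \<le> max 0 (max (2 * int i - 2 * int z) (int W - int z + int i))"
    and i: "i \<le> m"
  shows "2 * int (ones (F t) z i) \<le> max 0 (max (2 * int i - 2 * int z)
     (int W - int z + int i - int t + of_bool (odd (i + t))))"
  using i
proof (induction t arbitrary: i)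
  case 0
  then show ?case using init[of i] by (cases "odd i") simp_all
next
  case (Suc t)
  have p: "t mod 2 < 2" by simp
  have g: "\<forall>i<m. F (Suc t) i = F t (line_partner m (t mod 2) (F t) i)"
    using run by (simp add: line_run_def)
  consider "i = 0" | "i = m" | "even (i + t)" | "odd (i + t)" "0 < i" "i < m"
    using Suc.prems by linarith
  then show ?case
  proof cases
    case 1
    then show ?thesis by simp
  next
    case 2
    \<comment> \<open>At the right end the bound cannot improve with time: all values at least
      \<open>z\<close> are counted. This is the origin of the term
      \<open>2 * i - 2 * z\<close>.\<close>
    have "ones (F (Suc t)) z m \<le> m - z"
      using line_run_inj[OF run inj lt, of "Suc t"] by (intro ones_top) auto
    then show ?thesis using 2 z by simp
  next
    case 3
    then have "i mod 2 = t mod 2" by presburger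
    then have "ones (F (Suc t)) z i = ones (F t) z i"
      using Suc.prems by (intro ones_unchanged[OF p g]) auto
    then show ?thesis using Suc.IH[of i] Suc.prems 3 by simp
  next
    case 4
    then have "i mod 2 \<noteq> t mod 2" by presburger
    then have "ones (F (Suc t)) z i = max (ones (F t) z (i - 1)) (ones (F t) z (i + 1) - 1)"
      using 4 by (intro ones_changed[OF p g]) auto
    then have new: "ones (F (Suc t)) z i \<le> ones (F t) z (i - 1) \<or>
        ones (F (Suc t)) z i \<le> ones (F t) z (i + 1) - 1" by linarith
    \<comment> \<open>For both neighbours of \<open>i\<close> the sum of position and
      \<open>t\<close> is even, so their bounds hold without the lag.\<close>
    have "2 * int (ones (F t) z (i - 1)) \<le>
        max 0 (max (2 * (int i - 1) - 2 * int z) (int W - int z + (int i - 1) - int t))"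
      using Suc.IH[of "i - 1"] 4 by (simp add: of_nat_diff)
    then have l: "2 * int (ones (F t) z (i - 1)) \<le> 0 \<or>
        2 * int (ones (F t) z (i - 1)) \<le> 2 * int i - 2 * int z \<or>
        2 * int (ones (F t) z (i - 1)) \<le> int W - int z + int i - int (Suc t)"
      unfolding le_max_iff_disj by force
    have "2 * int (ones (F t) z (i + 1)) \<le>
        max 0 (max (2 * (int i + 1) - 2 * int z) (int W - int z + (int i + 1) - int t))"
      using Suc.IH[of "i + 1"] 4 by (simp add: algebra_simps)
    then have r: "2 * int (ones (F t) z (i + 1)) \<le> 0 \<or>
        2 * int (ones (F t) z (i + 1)) - 2 \<le> 2 * int i - 2 * int z \<or>
        2 * int (ones (F t) z (i + 1)) - 2 \<le> int W - int z + int i - int (Suc t)"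
      unfolding le_max_iff_disj by force
    have "2 * int (ones (F (Suc t)) z i) \<le>
        max 0 (max (2 * int i - 2 * int z) (int W - int z + int i - int (Suc t)))"
      unfolding le_max_iff_disj using new
    proof
      assume "ones (F (Suc t)) z i \<le> ones (F t) z (i - 1)"
      with l show "2 * int (ones (F (Suc t)) z i) \<le> 0 \<or>
        2 * int (ones (F (Suc t)) z i) \<le> 2 * int i - 2 * int z \<or>
        2 * int (ones (F (Suc t)) z i) \<le> int W - int z + int i - int (Suc t)" by linarith
    next
      assume "ones (F (Suc t)) z i \<le> ones (F t) z (i + 1) - 1"
      with r show "2 * int (ones (F (Suc t)) z i) \<le> 0 \<or>
        2 * int (ones (F (Suc t)) z i) \<le> 2 * int i - 2 * int z \<or>
        2 * int (ones (F (Suc t)) z i) \<le> int W - int z + int i - int (Suc t)" by linarith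
    qed
    then show ?thesis using 4 by simp
  qed
qed

lemma inj_le_imp_id:
  assumes "inj_on f {..<m}" "\<forall>q<m. f q \<le> q" "q < m"
  shows "f q = (q :: nat)"
  using assms(3)
proof (induction q rule: less_induct)
  case (less q)
  show ?case
  proof (rule ccontr)
    assume "f q \<noteq> q"
    then have lt: "f q < q" using assms(2) less.prems by (simp add: le_neq_implies_less)
    then have "f (f q) = f q" using less by simp
    then show False using assms(1) lt less.prems by (auto dest: inj_onD)
  qed
qed

lemma line_run_sorts:
  assumes run: "line_run m F" and inj: "inj_on (F 0) {..<m}" and lt: "\<forall>q<m. F 0 q < m"
    and init: "\<And>i z. i \<le> m \<Longrightarrow> z \<le> m \<Longrightarrow>
      2 * int (ones (F 0) z i) \<le> max 0 (max (2 * int i - 2 * int z) (int W - int z + int i))"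
    and q: "q < m"
  shows "F W q = q"
proof (rule inj_le_imp_id[OF _ _ q])
  show "inj_on (F W) {..<m}" using line_run_inj[OF run inj lt] by simp
  show "\<forall>q<m. F W q \<le> q"
  proof (intro allI impI)
    fix q assume q: "q < m"
    let ?z = "Suc q"
    \<comment> \<open>The cut lies right behind position \<open>q\<close> and the threshold is
      \<open>Suc q\<close>. The bound is then 0 or 1, and an even number below 2 is 0.\<close>
    have "2 * int (ones (F W) ?z ?z) \<le> max 0 (max (2 * int ?z - 2 * int ?z)
      (int W - int ?z + int ?z - int W + of_bool (odd (?z + W))))"
      by (rule line_run_ones[OF run inj lt _ init]) (use q in auto)
    then have "ones (F W) ?z ?z = 0"
      by (cases "odd (?z + W)") simp_all
    then show "F W q \<le> q" by (simp add: ones_Suc split: if_splits)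
  qed
qed

text \<open>The trivial bounds \<open>i\<close> and \<open>m - z\<close> on the prefix count add up
  to the initial condition with \<open>W = m\<close>.\<close>

lemma line_run_sorts_length:
  assumes run: "line_run m F" and inj: "inj_on (F 0) {..<m}" and lt: "\<forall>q<m. F 0 q < m"
    and q: "q < m"
  shows "F m q = q"
proof (rule line_run_sorts[OF run inj lt _ q])
  fix i z assume "i \<le> m" "z \<le> m"
  have "ones (F 0) z i \<le> ones (F 0) z m"
    unfolding ones_def by (rule card_mono) (use \<open>i \<le> m\<close> in auto)
  also have "\<dots> \<le> m - z" by (rule ones_top[OF inj lt])
  finally show "2 * int (ones (F 0) z i) \<le>
      max 0 (max (2 * int i - 2 * int z) (int m - int z + int i))"
    using ones_le[of "F 0" z i] \<open>z \<le> m\<close> by linarith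
qed

text \<open>The first round has parity 0 and compares the only pair. The general bound would give
  two rounds here, and an additive constant of 4 instead of 2 in the case
  \<open>h = 2\<close>.\<close>

lemma line_run_sorts_two:
  assumes run: "line_run 2 F" and inj: "inj_on (F 0) {..<2}" and lt: "\<forall>q<2. F 0 q < 2"
    and q: "q < 2"
  shows "F 1 q = q"
proof -
  have "F 0 0 < 2" "F 0 1 < 2" "F 0 0 \<noteq> F 0 1"
    using lt inj by (auto dest: inj_onD)
  moreover have "F 1 0 = F 0 (line_partner 2 0 (F 0) 0)" "F 1 1 = F 0 (line_partner 2 0 (F 0) 1)"
    using run unfolding line_run_def by (auto dest: spec[of _ 0])
  ultimately have "F 1 0 = 0" "F 1 1 = 1"
    by (auto simp: line_partner_def)
  then show ?thesis using q by (auto simp: less_2_cases_iff)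
qed

text \<open>Two bounds are averaged. Values at least \<open>z\<close> cannot lie left of
  \<open>z - d\<close>. Values below \<open>z\<close> lie left of \<open>z + d\<close>, so few of
  them are behind the cut at \<open>i\<close>; the rest occupy places in front of it, which leaves
  at most \<open>max d (i - z)\<close> places for values at least \<open>z\<close>.\<close>

lemma ones_displacement:
  assumes inj: "inj_on f {..<m}" and lt: "\<forall>q<m. f q < m"
    and d: "\<forall>q<m. q \<le> f q + d \<and> f q \<le> q + d" and i: "i \<le> m" and z: "z \<le> m"
  shows "2 * int (ones f z i) \<le> max 0 (max (2 * int i - 2 * int z) (int (2 * d) - int z + int i))"
proof -
  have "ones f z i \<le> card {z - d..<i}"
    unfolding ones_def
  proof (rule card_mono)
    show "{q. q < i \<and> z \<le> f q} \<subseteq> {z - d..<i}"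
    proof
      fix q assume "q \<in> {q. q < i \<and> z \<le> f q}"
      moreover from this have "f q \<le> q + d" using d i by simp
      ultimately show "q \<in> {z - d..<i}" by auto
    qed
  qed simp
  then have a: "ones f z i \<le> i - (z - d)" by simp
  \<comment> \<open>An injection of \<open>{..<m}\<close> into itself is a permutation, so every
    value below \<open>z\<close> occurs.\<close>
  have zeros: "card {q. q < m \<and> f q < z} = z"
  proof -
    have "f ` {..<m} = {..<m}"
      by (rule card_subset_eq) (use lt inj in \<open>auto simp: card_image\<close>)
    have "f ` {q. q < m \<and> f q < z} = {..<z}"
    proof (intro equalityI subsetI)
      fix y assume "y \<in> {..<z}"
      then have "y \<in> f ` {..<m}" using z \<open>f ` {..<m} = {..<m}\<close> by simp
      then show "y \<in> f ` {q. q < m \<and> f q < z}" using \<open>y \<in> {..<z}\<close> by auto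
    qed auto
    moreover have "inj_on f {q. q < m \<and> f q < z}"
      by (rule inj_on_subset[OF inj]) auto
    ultimately show ?thesis using card_image[of f "{q. q < m \<and> f q < z}"] by simp
  qed
  have "{q. q < m \<and> f q < z} \<subseteq> {q. q < i \<and> f q < z} \<union> {i..<z + d}"
  proof
    fix q assume "q \<in> {q. q < m \<and> f q < z}"
    moreover from this have "q \<le> f q + d" using d by simp
    ultimately show "q \<in> {q. q < i \<and> f q < z} \<union> {i..<z + d}" by auto
  qed
  then have "z \<le> card ({q. q < i \<and> f q < z} \<union> {i..<z + d})"
    by (subst zeros[symmetric], intro card_mono) auto
  also have "\<dots> \<le> card {q. q < i \<and> f q < z} + card {i..<z + d}" by (rule card_Un_le)
  finally have b: "z \<le> card {q. q < i \<and> f q < z} + (z + d - i)" by simp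
  have "card {q. q < i \<and> f q < z} + ones f z i = card ({q. q < i \<and> f q < z} \<union> {q. q < i \<and> z \<le> f q})"
    unfolding ones_def by (rule card_Un_disjoint[symmetric]) auto
  also have "{q. q < i \<and> f q < z} \<union> {q. q < i \<and> z \<le> f q} = {..<i}" by auto
  finally have "card {q. q < i \<and> f q < z} + ones f z i = i" by simp
  with a b show ?thesis by linarith
qed

lemma line_run_sorts_displacement:
  assumes run: "line_run m F" and inj: "inj_on (F 0) {..<m}" and lt: "\<forall>q<m. F 0 q < m"
    and d: "\<forall>q<m. q \<le> F 0 q + d \<and> F 0 q \<le> q + d" and q: "q < m"
  shows "F (2 * d) q = q"
  by (rule line_run_sorts[OF run inj lt ones_displacement[OF inj lt d] q])

section \<open>Grids and their lines\<close>

lemma apply_matching_comp: "apply_matching M C v = C (apply_matching M (\<lambda>v. v) v)"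
  by (simp add: apply_matching_def)

text \<open>Matchings act on positions and ignore tokens. Applied to the identity, they tell from
  which vertex the token finally lying on \<open>v\<close> started.\<close>

lemma fold_apply_matching_comp: "fold apply_matching Ms C v = C (fold apply_matching Ms (\<lambda>v. v) v)"
proof (induction Ms arbitrary: v rule: rev_induct)
  case Nil
  then show ?case by simp
next
  case (snoc M Ms)
  show ?case using snoc[of "apply_matching M (\<lambda>v. v) v"]
    by (simp add: apply_matching_comp[of M "fold apply_matching Ms C"]
        apply_matching_comp[of M "fold apply_matching Ms (\<lambda>v. v)"])
qed

section \<open>Row-major cell numbers, from 0, and the encoding of maps\<close>

definition vertex :: "nat \<Rightarrow> nat \<Rightarrow> nat \<times> nat" where
  "vertex n i = (i div n + 1, i mod n + 1)"

lemma div_less_rows: "i < h * n \<Longrightarrow> i div n < (h :: nat)"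
  by (simp add: less_mult_imp_div_less)

lemma mod_less_cols: "i < h * n \<Longrightarrow> i mod n < (n :: nat)"
  by (cases "n = 0") simp_all

lemma cell_less: "r < h \<Longrightarrow> c < n \<Longrightarrow> r * n + c < h * (n :: nat)"
proof -
  assume "r < h" "c < n"
  then have "r * n + c < Suc r * n" by simp
  also have "\<dots> \<le> h * n" using \<open>r < h\<close> by (intro mult_right_mono) simp_all
  finally show ?thesis .
qed

lemma vertex_inj: "vertex n i = vertex n j \<longleftrightarrow> i = j"
  unfolding vertex_def by (metis add_right_cancel div_mult_mod_eq prod.inject)

lemma vertex_grid: "i < h * n \<Longrightarrow> vertex n i \<in> verts (grid h n)"
  using div_less_rows[of i h n] mod_less_cols[of i h n] by (simp add: vertex_def grid_def)

lemma verts_grid: "verts (grid h n) = vertex n ` {..<h * n}"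
proof (intro equalityI subsetI)
  fix v assume "v \<in> verts (grid h n)"
  then obtain a b where v: "v = (Suc a, Suc b)" "a < h" "b < n"
    by (cases v; cases "fst v"; cases "snd v") (auto simp: grid_def)
  then have "vertex n (a * n + b) = v" by (simp add: vertex_def)
  then show "v \<in> vertex n ` {..<h * n}" using cell_less[OF v(2,3)] by force
qed (use vertex_grid in auto)

lemma product_vertices: "List.product [1..<h + 1] [1..<n + 1] = map (vertex n) [0..<h * n]"
  by (rule nth_equalityI)
    (use div_less_rows mod_less_cols in \<open>auto simp: product_nth vertex_def simp del: upt_Suc\<close>)

lemma encode_map_cells:
  "encode_map h n f = concat (map (\<lambda>i. [fst (f (vertex n i)), snd (f (vertex n i))]) [0..<h * n])"
  unfolding encode_map_def product_vertices by (simp add: comp_def)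

lemma length_concat_pairs: "length (concat (map (\<lambda>i. [f i, g i]) [0..<N])) = 2 * N"
  by (induction N) simp_all

lemma nth_concat_pairs:
  "i < N \<Longrightarrow> concat (map (\<lambda>i. [f i, g i]) [0..<N]) ! (2 * i) = f i \<and>
    concat (map (\<lambda>i. [f i, g i]) [0..<N]) ! Suc (2 * i) = g i"
proof (induction N)
  case (Suc N)
  then show ?case
    by (cases "i = N") (simp_all add: nth_append length_concat_pairs del: upt_Suc add: upt_Suc_append)
qed simp

section \<open>Matchings as involutions of the cells\<close>

definition involution_matching :: "nat \<Rightarrow> nat \<Rightarrow> (nat \<Rightarrow> nat) \<Rightarrow> (nat \<times> nat) set set" where
  "involution_matching N n p = {{vertex n i, vertex n (p i)} | i. i < N \<and> p i \<noteq> i}"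

lemma involution_matching_iff:
  assumes p: "\<And>i. i < N \<Longrightarrow> p i < N \<and> p (p i) = i" and i: "i < N"
  shows "{vertex n i, w} \<in> involution_matching N n p \<longleftrightarrow> p i \<noteq> i \<and> w = vertex n (p i)"
proof
  assume "{vertex n i, w} \<in> involution_matching N n p"
  then obtain j where "{vertex n i, w} = {vertex n j, vertex n (p j)}" "j < N" "p j \<noteq> j"
    by (auto simp: involution_matching_def)
  then show "p i \<noteq> i \<and> w = vertex n (p i)"
    using p by (auto simp: doubleton_eq_iff vertex_inj)
next
  assume "p i \<noteq> i \<and> w = vertex n (p i)"
  then show "{vertex n i, w} \<in> involution_matching N n p"
    using i unfolding involution_matching_def by blast
qed

lemma apply_involution_matching:
  assumes p: "\<And>i. i < N \<Longrightarrow> p i < N \<and> p (p i) = i" and i: "i < N"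
  shows "apply_matching (involution_matching N n p) C (vertex n i) = C (vertex n (p i))"
  using involution_matching_iff[OF assms] by (cases "p i = i") (simp_all add: apply_matching_def)

lemma matching_involution_matching:
  assumes p: "\<And>i. i < N \<Longrightarrow> p i < N \<and> p (p i) = i"
    and e: "\<And>i. i < N \<Longrightarrow> p i \<noteq> i \<Longrightarrow> {vertex n i, vertex n (p i)} \<in> edges G"
  shows "matching G (involution_matching N n p)"
  unfolding matching_def
proof (intro conjI ballI impI)
  show "involution_matching N n p \<subseteq> edges G" using e by (auto simp: involution_matching_def)
  fix a b assume "a \<in> involution_matching N n p" "b \<in> involution_matching N n p" "a \<noteq> b"
  then obtain i j where "a = {vertex n i, vertex n (p i)}" "i < N"
    "b = {vertex n j, vertex n (p j)}" "j < N" by (auto simp: involution_matching_def)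
  note ab = this
  show "a \<inter> b = {}"
  proof (rule ccontr)
    assume "a \<inter> b \<noteq> {}"
    then have "i = j \<or> i = p j \<or> p i = j \<or> p i = p j"
      unfolding ab by (auto simp: vertex_inj)
    then have "i = j \<or> p i = j \<and> p j = i" using p[OF ab(2)] p[OF ab(4)] by metis
    then show False using \<open>a \<noteq> b\<close> unfolding ab by (auto simp: insert_commute)
  qed
qed

text \<open>\<open>ys\<close> encodes \<open>k\<close> matchings that move the token from cell \<open>A i\<close> to cell \<open>i\<close>.\<close>

definition emitted ::
    "nat \<Rightarrow> nat \<Rightarrow> (nat \<times> nat \<Rightarrow> nat \<times> nat) \<Rightarrow> nat \<Rightarrow> (nat \<Rightarrow> nat) \<Rightarrow> nat list \<Rightarrow> bool" where
  "emitted h n C k A ys \<longleftrightarrow> (\<exists>Ms. ys = encode_solution h n Ms \<and> (\<forall>M\<in>set Ms. matching (grid h n) M) \<and>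
     length Ms = k \<and> (\<forall>i<h * n. fold apply_matching Ms C (vertex n i) = C (vertex n (A i))))"

lemma emitted_Nil: "\<forall>i<h * n. A i = i \<Longrightarrow> emitted h n C 0 A []"
  unfolding emitted_def encode_solution_def by (intro exI[of _ "[]"]) simp

text \<open>The appended numbers are the partner table of the matching formed by the 2-cycles of
  \<open>p\<close>. Since \<open>A\<close> maps cells to starting cells, the exchange is a
  composition with \<open>p\<close> on the inside.\<close>

lemma emitted_step:
  assumes em: "emitted h n C k A ys"
    and p: "\<And>i. i < h * n \<Longrightarrow> p i < h * n \<and> p (p i) = i"
    and e: "\<And>i. i < h * n \<Longrightarrow> p i \<noteq> i \<Longrightarrow> {vertex n i, vertex n (p i)} \<in> edges (grid h n)"
    and A': "\<And>i. i < h * n \<Longrightarrow> A' i = A (p i)"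
  shows "emitted h n C (Suc k) A'
    (ys @ concat (map (\<lambda>i. [p i div n + 1, p i mod n + 1]) [0..<h * n]))"
proof -
  obtain Ms where Ms: "ys = encode_solution h n Ms" "\<forall>M\<in>set Ms. matching (grid h n) M"
    "length Ms = k" "\<forall>i<h * n. fold apply_matching Ms C (vertex n i) = C (vertex n (A i))"
    using em by (auto simp: emitted_def)
  let ?M = "involution_matching (h * n) n p"
  have ap: "apply_matching ?M f (vertex n i) = f (vertex n (p i))" if "i < h * n"
    for f :: "nat \<times> nat \<Rightarrow> nat \<times> nat" and i
    by (rule apply_involution_matching[OF p that])
  have "map (\<lambda>i. [fst (apply_matching ?M (\<lambda>v. v) (vertex n i)),
      snd (apply_matching ?M (\<lambda>v. v) (vertex n i))]) [0..<h * n] =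
      map (\<lambda>i. [p i div n + 1, p i mod n + 1]) [0..<h * n]"
    by (rule map_cong) (simp_all add: ap, simp add: vertex_def)
  then have "encode_map h n (apply_matching ?M (\<lambda>v. v)) =
      concat (map (\<lambda>i. [p i div n + 1, p i mod n + 1]) [0..<h * n])"
    unfolding encode_map_cells by (rule arg_cong)
  then have "encode_solution h n (Ms @ [?M]) =
      ys @ concat (map (\<lambda>i. [p i div n + 1, p i mod n + 1]) [0..<h * n])"
    using Ms(1) unfolding encode_solution_def by simp
  moreover have "matching (grid h n) ?M" by (rule matching_involution_matching[OF p e])
  moreover have "fold apply_matching (Ms @ [?M]) C (vertex n i) = C (vertex n (A' i))"
    if "i < h * n" for i
    using ap[OF that, of "fold apply_matching Ms C"] Ms(4) p[OF that] A'[OF that] by simp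
  ultimately show ?thesis
    unfolding emitted_def using Ms(2,3) by (intro exI[of _ "Ms @ [?M]"]) auto
qed

section \<open>Column displacement as a lower bound on the optimum\<close>

lemma apply_matching_mem:
  assumes "matching G M"
  shows "apply_matching M (\<lambda>v. v) v = v \<or> {v, apply_matching M (\<lambda>v. v) v} \<in> edges G"
proof (cases "\<exists>w. {v, w} \<in> M")
  case True
  then obtain w where w: "{v, w} \<in> M" by blast
  have "(THE w. {v, w} \<in> M) = w"
  proof (rule the_equality)
    show "{v, w} \<in> M" by (rule w)
    fix u assume u: "{v, u} \<in> M"
    have "{v, u} = {v, w}"
    proof (rule ccontr)
      assume "{v, u} \<noteq> {v, w}"
      then have "{v, u} \<inter> {v, w} = {}"
        using assms u w unfolding matching_def by meson
      then show False by simp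
    qed
    then show "u = w" by (metis doubleton_eq_iff)
  qed
  then show ?thesis using True w assms by (auto simp: apply_matching_def matching_def)
qed (simp add: apply_matching_def)

lemma grid_edge:
  assumes "{(a, b), (a', b')} \<in> edges (grid h n)"
  shows "(a', b') \<in> verts (grid h n) \<and> b' \<le> b + 1 \<and> b \<le> b' + 1"
  using assms by (auto simp: grid_def doubleton_eq_iff)

lemma fold_matchings_column:
  assumes "\<forall>M\<in>set Ms. matching (grid h n) M" "v \<in> verts (grid h n)"
  defines "u \<equiv> fold apply_matching Ms (\<lambda>v. v) v"
  shows "u \<in> verts (grid h n) \<and> snd u \<le> snd v + length Ms \<and> snd v \<le> snd u + length Ms"
  using assms(1,2) unfolding u_def
proof (induction Ms arbitrary: v rule: rev_induct)
  case Nil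
  then show ?case by simp
next
  case (snoc M Ms)
  let ?w = "apply_matching M (\<lambda>v. v) v"
  have "?w = v \<or> {v, ?w} \<in> edges (grid h n)"
    using snoc.prems(1) by (intro apply_matching_mem) auto
  then have "?w \<in> verts (grid h n) \<and> snd ?w \<le> snd v + 1 \<and> snd v \<le> snd ?w + 1"
    using snoc.prems(2) grid_edge[of "fst v" "snd v" "fst ?w" "snd ?w" h n] by auto
  then show ?case using snoc.IH[of ?w] snoc.prems(1)
    by (fastforce simp: apply_matching_comp[of M "fold apply_matching Ms (\<lambda>v. v)"])
qed

lemma solution_displacement:
  assumes sol: "solution (grid h n) C Ms" and C: "configuration (grid h n) C"
    and u: "u \<in> verts (grid h n)"
  shows "snd (C u) \<le> snd u + length Ms \<and> snd u \<le> snd (C u) + length Ms"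
proof -
  let ?F = "fold apply_matching Ms (\<lambda>v. v)"
  have Cu: "C u \<in> verts (grid h n)"
    using C u unfolding configuration_def by (rule bij_betwE[THEN bspec])
  have M: "\<forall>M\<in>set Ms. matching (grid h n) M" using sol by (simp add: solution_def)
  note F = fold_matchings_column[OF M Cu]
  \<comment> \<open>The token that ends on \<open>C u\<close> is \<open>C u\<close> itself;
    injectivity of \<open>C\<close> identifies its starting vertex as \<open>u\<close>.\<close>
  have "C (?F (C u)) = C u"
    using sol Cu fold_apply_matching_comp[of Ms C "C u"] by (simp add: solution_def)
  then have "?F (C u) = u"
    using C F u unfolding configuration_def by (auto dest: bij_betw_imp_inj_on inj_onD)
  then show ?thesis using F by auto
qed

text \<open>The \<open>LEAST\<close> in \<open>OPT\<close> is attained once some solution exists.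
  The solution found by the algorithm will serve as this witness.\<close>

lemma displacement_le_OPT:
  assumes "solution (grid h n) C Ms" and C: "configuration (grid h n) C"
    and u: "u \<in> verts (grid h n)"
  shows "snd (C u) \<le> snd u + OPT (grid h n) C \<and> snd u \<le> snd (C u) + OPT (grid h n) C"
proof -
  have "\<exists>Ms'. solution (grid h n) C Ms' \<and> length Ms' = OPT (grid h n) C"
    unfolding OPT_def by (rule LeastI[of _ "length Ms"]) (use assms in blast)
  then show ?thesis using solution_displacement[OF _ C u] by metis
qed

section \<open>Odd-even transposition on all parallel lines at once\<close>

lemma line_partner_cases:
  "line_partner m p f i = i \<or> line_partner m p f i = Suc i \<or> i = Suc (line_partner m p f i)"
  by (auto simp: line_partner_def)

text \<open>Treats both directions: columns are \<open>n\<close> lines of \<open>h\<close> cells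
  with stride \<open>d = n\<close>, rows are \<open>h\<close> lines of \<open>n\<close> cells with
  stride 1. Programs only use \<open>pos\<close> and the stride; \<open>ln\<close> and
  \<open>cell\<close> serve the transfer from single paths.\<close>

locale grid_lines =
  fixes h n l m d :: nat and pos ln :: "nat \<Rightarrow> nat" and cell :: "nat \<Rightarrow> nat \<Rightarrow> nat"
  assumes cell_pos: "i < h * n \<Longrightarrow> cell (ln i) (pos i) = i"
    and pos_less: "i < h * n \<Longrightarrow> pos i < m"
    and ln_less: "i < h * n \<Longrightarrow> ln i < l"
    and cell_lt: "a < l \<Longrightarrow> q < m \<Longrightarrow> cell a q < h * n"
    and ln_cell: "a < l \<Longrightarrow> q < m \<Longrightarrow> ln (cell a q) = a"
    and pos_cell: "a < l \<Longrightarrow> q < m \<Longrightarrow> pos (cell a q) = q"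
    and cell_Suc: "a < l \<Longrightarrow> Suc q < m \<Longrightarrow> cell a (Suc q) = cell a q + d"
    and edge: "a < l \<Longrightarrow> Suc q < m \<Longrightarrow>
      {vertex n (cell a q), vertex n (cell a (Suc q))} \<in> edges (grid h n)"
begin

definition partner :: "nat \<Rightarrow> (nat \<Rightarrow> nat) \<Rightarrow> nat \<Rightarrow> nat" where
  "partner p f i =
     (if pos i mod 2 = p \<and> pos i + 1 < m \<and> f (i + d) < f i then i + d
      else if pos i mod 2 \<noteq> p \<and> 0 < pos i \<and> f i < f (i - d) then i - d
      else i)"

lemma partner_cell:
  assumes "a < l" "q < m"
  shows "partner p f (cell a q) = cell a (line_partner m p (\<lambda>q. f (cell a q)) q)"
proof (cases q)
  case 0
  then show ?thesis using assms cell_Suc[of a q]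
    by (auto simp: partner_def line_partner_def pos_cell)
next
  case (Suc k)
  then have "cell a q - d = cell a k" using cell_Suc[of a k] assms by simp
  then show ?thesis using assms Suc cell_Suc[of a q]
    by (auto simp: partner_def line_partner_def pos_cell)
qed

lemma partner_props:
  assumes i: "i < h * n" and p: "p < 2"
  shows "partner p f i < h * n" "partner p f (partner p f i) = i" "ln (partner p f i) = ln i"
    "partner p f i \<noteq> i \<Longrightarrow> {vertex n i, vertex n (partner p f i)} \<in> edges (grid h n)"
proof -
  let ?l = "line_partner m p (\<lambda>q. f (cell (ln i) q))"
  have q: "pos i < m" "ln i < l" using i pos_less ln_less by auto
  have eq: "partner p f i = cell (ln i) (?l (pos i))"
    using partner_cell[OF q(2,1)] cell_pos[OF i] by simp
  have lt: "?l (pos i) < m" using line_partner_lt[OF q(1)] .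
  show "partner p f i < h * n" "ln (partner p f i) = ln i"
    using eq cell_lt ln_cell q lt by simp_all
  show "partner p f (partner p f i) = i"
    using eq partner_cell[OF q(2) lt] line_partner_idem[OF p q(1)] cell_pos[OF i] by simp
  assume ne: "partner p f i \<noteq> i"
  then have "?l (pos i) \<noteq> pos i" using eq cell_pos[OF i] by auto
  then have "?l (pos i) = Suc (pos i) \<or> pos i = Suc (?l (pos i))"
    using line_partner_cases[of m p "\<lambda>q. f (cell (ln i) q)" "pos i"] by simp
  then show "{vertex n i, vertex n (partner p f i)} \<in> edges (grid h n)"
  proof
    assume "?l (pos i) = Suc (pos i)"
    then show ?thesis using edge[OF q(2), of "pos i"] lt eq cell_pos[OF i] by simp
  next
    assume *: "pos i = Suc (?l (pos i))"
    then have "{vertex n (cell (ln i) (?l (pos i))), vertex n (cell (ln i) (pos i))} \<in> edges (grid h n)"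
      using edge[OF q(2), of "?l (pos i)"] q(1) by metis
    then show ?thesis using eq cell_pos[OF i] by (simp add: insert_commute)
  qed
qed

text \<open>Values are the starting cells of tokens, and \<open>K\<close> is the sorting key of a
  token. Outside the grid nothing changes, so that the result can be equated with a whole array of
  the program.\<close>

fun arrangement :: "(nat \<Rightarrow> nat) \<Rightarrow> (nat \<Rightarrow> nat) \<Rightarrow> nat \<Rightarrow> nat \<Rightarrow> nat" where
  "arrangement K A 0 = A"
| "arrangement K A (Suc t) = (\<lambda>i. if i < h * n
     then arrangement K A t (partner (t mod 2) (\<lambda>i. K (arrangement K A t i)) i)
     else arrangement K A t i)"

lemma arrangement_line:
  assumes "i < h * n"
  shows "\<exists>j<h * n. ln j = ln i \<and> arrangement K A t i = A j"
  using assms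
proof (induction t arbitrary: i)
  case (Suc t)
  let ?p = "partner (t mod 2) (\<lambda>i. K (arrangement K A t i)) i"
  have "?p < h * n" "ln ?p = ln i" using partner_props(1,3)[OF Suc.prems] by simp_all
  then show ?case using Suc.IH[of ?p] Suc.prems by simp
qed auto

lemma arrangement_line_inj:
  assumes "inj_on A {..<h * n}" "\<forall>i<h * n. A i < h * n"
  shows "inj_on (arrangement K A t) {..<h * n} \<and> (\<forall>i<h * n. arrangement K A t i < h * n)"
proof (induction t)
  case 0
  then show ?case using assms by simp
next
  case (Suc t)
  let ?p = "partner (t mod 2) (\<lambda>i. K (arrangement K A t i))"
  have "inj_on ?p {..<h * n}"
    by (rule inj_on_inverseI[where g = ?p]) (simp add: partner_props)
  moreover have "?p ` {..<h * n} \<subseteq> {..<h * n}" using partner_props(1) by auto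
  ultimately have "inj_on (arrangement K A t \<circ> ?p) {..<h * n}"
    using Suc by (meson comp_inj_on inj_on_subset)
  then show ?case using Suc \<open>?p ` {..<h * n} \<subseteq> {..<h * n}\<close> by (auto simp: inj_on_def)
qed

lemma line_run_arrangement:
  assumes "a < l"
  shows "line_run m (\<lambda>t q. K (arrangement K A t (cell a q)))"
  unfolding line_run_def using partner_cell[OF assms] cell_lt[OF assms] line_partner_lt
  by simp

text \<open>The alternatives for \<open>W\<close> belong to the column phases with \<open>h\<close>
  at least 3, the column phases with \<open>h = 2\<close>, and the row phase. The bound
  \<open>d\<close> in the last one is a displacement, not the stride of the locale.\<close>

lemma arrangement_sorted:
  assumes inj: "\<And>a. a < l \<Longrightarrow> inj_on (\<lambda>q. K (A (cell a q))) {..<m}"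
    and lt: "\<And>i. i < h * n \<Longrightarrow> K (A i) < m"
    and W: "W = m \<or> (W = 1 \<and> m = 2) \<or>
      (\<exists>d. W = 2 * d \<and> (\<forall>i<h * n. pos i \<le> K (A i) + d \<and> K (A i) \<le> pos i + d))"
    and i: "i < h * n"
  shows "K (arrangement K A W i) = pos i"
proof -
  let ?F = "\<lambda>t q. K (arrangement K A t (cell (ln i) q))"
  have a: "ln i < l" using ln_less[OF i] .
  have inj': "inj_on (?F 0) {..<m}" using inj[OF a] by simp
  have lt': "\<forall>q<m. ?F 0 q < m" using lt cell_lt[OF a] by simp
  note run = line_run_arrangement[OF a, of K A]
  from W have "?F W (pos i) = pos i"
  proof (elim disjE exE conjE)
    assume "W = m"
    with line_run_sorts_length[OF run inj' lt' pos_less[OF i]] show ?thesis by simp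
  next
    assume *: "W = 1" "m = 2"
    show ?thesis unfolding * by (rule line_run_sorts_two) (use run inj' lt' pos_less[OF i] * in auto)
  next
    fix d assume *: "W = 2 * d" "\<forall>i<h * n. pos i \<le> K (A i) + d \<and> K (A i) \<le> pos i + d"
    show ?thesis unfolding *(1)
    proof (rule line_run_sorts_displacement[OF run inj' lt' _ pos_less[OF i]])
      show "\<forall>q<m. q \<le> ?F 0 q + d \<and> ?F 0 q \<le> q + d"
        using *(2) cell_lt[OF a] pos_cell[OF a] by fastforce
    qed
  qed
  then show ?thesis using cell_pos[OF i] by simp
qed

end

lemma grid_lines_vertical:
  assumes "0 < n"
  shows "grid_lines h n n h n (\<lambda>i. i div n) (\<lambda>i. i mod n) (\<lambda>a q. q * n + a)"
proof
  fix a q assume *: "a < n" "Suc q < h"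
  then have "vertex n (q * n + a) = (q + 1, a + 1)" "vertex n (Suc q * n + a) = (q + 1 + 1, a + 1)"
    by (simp_all add: vertex_def div_add1_eq del: mult_Suc)
  moreover have "{(q + 1, a + 1), (q + 1 + 1, a + 1)} \<in> edges (grid h n)"
    using * unfolding grid_def by (simp only: snd_conv, intro UnI1) force
  ultimately show "{vertex n (q * n + a), vertex n (Suc q * n + a)} \<in> edges (grid h n)" by simp
qed (use assms div_less_rows mod_less_cols cell_less in auto)

lemma grid_lines_horizontal:
  assumes "0 < n"
  shows "grid_lines h n h n 1 (\<lambda>i. i mod n) (\<lambda>i. i div n) (\<lambda>a q. a * n + q)"
proof
  fix a q assume *: "a < h" "Suc q < n"
  then have "vertex n (a * n + q) = (a + 1, q + 1)" "vertex n (a * n + Suc q) = (a + 1, q + 1 + 1)"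
    by (simp_all add: vertex_def del: add_Suc_right)
  moreover have "{(a + 1, q + 1), (a + 1, q + 1 + 1)} \<in> edges (grid h n)"
    using * unfolding grid_def by (simp only: snd_conv, intro UnI2) force
  ultimately show "{vertex n (a * n + q), vertex n (a * n + Suc q)} \<in> edges (grid h n)" by simp
qed (use assms div_less_rows mod_less_cols cell_less in auto)

section \<open>Distributing the tokens of each column over the rows\<close>

lemma cell_eq_iff: "c < n \<Longrightarrow> c' < n \<Longrightarrow> r * n + c = r' * n + c' \<longleftrightarrow> r = r' \<and> c = (c' :: nat)"
  by (metis add.commute mod_mult_self1 mod_less div_mult_self1 div_less add_0_left
      less_nat_zero_code add_left_cancel mult_cancel_right)

definition swap_rows :: "nat \<Rightarrow> nat \<Rightarrow> nat \<Rightarrow> nat" where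
  "swap_rows r s q = (if q = r then s else if q = s then r else q)"

lemma swap_rows_simps [simp]: "swap_rows r s r = s" "swap_rows r s s = r"
  by (simp_all add: swap_rows_def)

text \<open>In \<open>X\<close>, cell \<open>r * n + c\<close> holds the token that starts in row \<open>X (r * n + c)\<close> of column \<open>c\<close>;
  \<open>target X r c\<close> is the target column of this token.\<close>

locale column_targets =
  fixes h n :: nat and T :: "nat \<Rightarrow> nat"
  assumes T_less: "i < h * n \<Longrightarrow> T i < n"
begin

definition target :: "(nat \<Rightarrow> nat) \<Rightarrow> nat \<Rightarrow> nat \<Rightarrow> nat" where
  "target X r c = T (X (r * n + c) * n + c)"

definition occ :: "(nat \<Rightarrow> nat) \<Rightarrow> nat set \<Rightarrow> nat \<Rightarrow> nat \<Rightarrow> nat" where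
  "occ X U r v = card {c \<in> U. target X r c = v}"

abbreviation count :: "(nat \<Rightarrow> nat) \<Rightarrow> nat \<Rightarrow> nat \<Rightarrow> nat" where
  "count X r v \<equiv> occ X {..<n} r v"

text \<open>Colours are rows. In this representation the edges at a current column always carry each
  colour once, so only properness at the target columns has to be achieved.\<close>

definition columnwise :: "(nat \<Rightarrow> nat) \<Rightarrow> bool" where
  "columnwise X \<longleftrightarrow> (\<forall>c<n. bij_betw (\<lambda>r. X (r * n + c)) {..<h} {..<h})"

definition potential :: "(nat \<Rightarrow> nat) \<Rightarrow> nat" where
  "potential X = (\<Sum>r<h. \<Sum>v<n. (count X r v)\<^sup>2)"

definition exchange :: "nat \<Rightarrow> nat \<Rightarrow> nat \<Rightarrow> (nat \<Rightarrow> nat) \<Rightarrow> (nat \<Rightarrow> nat)" where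
  "exchange r s c X = X(r * n + c := X (s * n + c), s * n + c := X (r * n + c))"

text \<open>Regard column \<open>c\<close> as an arc from \<open>target X r c\<close> to \<open>target X s c\<close>; exchanging the rows \<open>r\<close>
  and \<open>s\<close> in column \<open>c\<close> reverses this arc.  \<open>U\<close> is the set of reversed arcs of a trail from
  \<open>j\<close> to \<open>k\<close>.\<close>

definition trail :: "(nat \<Rightarrow> nat) \<Rightarrow> nat \<Rightarrow> nat \<Rightarrow> nat \<Rightarrow> (nat \<Rightarrow> nat) \<Rightarrow> nat set \<Rightarrow> nat \<Rightarrow> bool" where
  "trail X0 r s j X U k \<longleftrightarrow> U \<subseteq> {..<n} \<and> k < n \<and>
     (\<forall>q<h. \<forall>c<n. X (q * n + c) = X0 ((if c \<in> U then swap_rows r s q else q) * n + c)) \<and>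
     (\<forall>v. int (occ X U r v) - int (occ X U s v) = of_bool (v = k) - of_bool (v = j))"

lemma occ_split: "U \<subseteq> {..<n} \<Longrightarrow> count X r v = occ X U r v + occ X ({..<n} - U) r v"
proof -
  assume U: "U \<subseteq> {..<n}"
  then have f: "finite U" using finite_subset by blast
  have "{c \<in> {..<n}. target X r c = v} = {c \<in> U. target X r c = v} \<union> {c \<in> {..<n} - U. target X r c = v}"
    using U by auto
  then show ?thesis unfolding occ_def using f by (simp add: card_Un_disjoint disjoint_iff)
qed

lemma trail_refl: "j < n \<Longrightarrow> trail X r s j X {} j"
  by (simp add: trail_def occ_def)

lemma trail_target:
  assumes "trail X0 r s j X U k" "q < h" "c < n"
  shows "target X q c = target X0 (if c \<in> U then swap_rows r s q else q) c"
  using assms by (simp add: trail_def target_def)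

lemma trail_occ:
  assumes tr: "trail X0 r s j X U k" and rs: "r < h" "s < h"
  shows "occ X U r v = occ X0 U s v" "occ X U s v = occ X0 U r v"
    "q < h \<Longrightarrow> occ X ({..<n} - U) q v = occ X0 ({..<n} - U) q v"
    "q < h \<Longrightarrow> q \<noteq> r \<Longrightarrow> q \<noteq> s \<Longrightarrow> count X q v = count X0 q v"
proof -
  have U: "U \<subseteq> {..<n}" using tr by (simp add: trail_def)
  have U': "c < n" if "c \<in> U" for c using U that by auto
  show "occ X U r v = occ X0 U s v" "occ X U s v = occ X0 U r v"
    unfolding occ_def
    by (intro arg_cong[where f = card] Collect_cong conj_cong refl, simp add: U' trail_target[OF tr] rs)+
  show "q < h \<Longrightarrow> occ X ({..<n} - U) q v = occ X0 ({..<n} - U) q v"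
    unfolding occ_def by (rule arg_cong[where f = card]) (use trail_target[OF tr] in auto)
  show "q < h \<Longrightarrow> q \<noteq> r \<Longrightarrow> q \<noteq> s \<Longrightarrow> count X q v = count X0 q v"
    unfolding occ_def
    by (rule arg_cong[where f = card]) (use trail_target[OF tr] in \<open>auto simp: swap_rows_def\<close>)
qed

text \<open>The reversed arcs give \<open>r\<close> a surplus over \<open>s\<close> of at most 1 at
  the end \<open>k\<close>. A total surplus of 2 therefore needs an arc leaving \<open>k\<close>
  that is not yet reversed.\<close>

lemma trail_next:
  assumes tr: "trail X0 r s j X U k" and big: "count X s k + 1 < count X r k"
  shows "\<exists>c<n. c \<notin> U \<and> target X r c = k"
proof -
  have U: "U \<subseteq> {..<n}" and "int (occ X U r k) - int (occ X U s k) \<le> 1"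
    using tr by (auto simp: trail_def)
  then have "occ X ({..<n} - U) r k \<noteq> 0"
    using big occ_split[OF U, of X r k] occ_split[OF U, of X s k] by linarith
  then have "{c \<in> {..<n} - U. target X r c = k} \<noteq> {}"
    unfolding occ_def by (metis card.empty)
  then show ?thesis by auto
qed

text \<open>The new reversed arc adds 1 at its head and subtracts 1 at its tail \<open>k\<close>, so
  the balance telescopes to the two ends of the longer trail.\<close>

lemma trail_step:
  assumes tr: "trail X0 r s j X U k" and rs: "r < h" "s < h" "r \<noteq> s"
    and c: "c < n" "c \<notin> U" "target X r c = k" and k': "target X s c < n"
  shows "trail X0 r s j (exchange r s c X) (insert c U) (target X s c)"
proof -
  let ?X = "exchange r s c X"
  have U: "U \<subseteq> {..<n}" using tr by (simp add: trail_def)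
  have fin: "finite U" using U finite_subset by blast
  have X: "?X (q * n + c') = X ((if c' = c then swap_rows r s q else q) * n + c')" if "c' < n" for q c'
    using that c(1) rs(3) by (auto simp: exchange_def cell_eq_iff swap_rows_def)
  then have t: "target ?X q c' = target X (if c' = c then swap_rows r s q else q) c'" if "c' < n" for q c'
    using that by (simp add: target_def)
  have occ: "occ ?X (insert c U) q v = occ X U q v + of_bool (target X (swap_rows r s q) c = v)" for q v
  proof -
    have "{a \<in> insert c U. target ?X q a = v} =
      (if target X (swap_rows r s q) c = v then insert c {a \<in> U. target X q a = v}
       else {a \<in> U. target X q a = v})"
      using t c U by (auto simp: subset_iff)
    then show ?thesis using fin c(2) by (simp add: occ_def)
  qed
  have "int (occ ?X (insert c U) r v) - int (occ ?X (insert c U) s v) =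
      of_bool (v = target X s c) - of_bool (v = j)" for v
  proof -
    have "int (occ X U r v) - int (occ X U s v) = of_bool (v = k) - of_bool (v = j)"
      using tr by (simp add: trail_def)
    then show ?thesis by (simp add: occ c(3) eq_commute[of v])
  qed
  moreover have "?X (q * n + c') = X0 ((if c' \<in> insert c U then swap_rows r s q else q) * n + c')"
    if "q < h" "c' < n" for q c'
  proof (cases "c' = c")
    case True
    have "swap_rows r s q < h" using that(1) rs by (auto simp: swap_rows_def)
    then show ?thesis using tr X[OF that(2), of q] that c(2) True by (simp add: trail_def)
  next
    case False
    then show ?thesis using tr X[OF that(2), of q] that by (simp add: trail_def)
  qed
  ultimately show ?thesis using U c(1) k' unfolding trail_def by blast
qed

lemma trail_columnwise:
  assumes tr: "trail X0 r s j X U k" and rs: "r < h" "s < h" and X0: "columnwise X0"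
  shows "columnwise X"
  unfolding columnwise_def
proof (intro allI impI)
  fix c assume c: "c < n"
  let ?p = "\<lambda>q. if c \<in> U then swap_rows r s q else q"
  have "bij_betw ?p {..<h} {..<h}"
    using rs by (intro bij_betw_byWitness[where f' = ?p]) (auto simp: swap_rows_def)
  moreover have "bij_betw (\<lambda>q. X0 (q * n + c)) {..<h} {..<h}" using X0 c by (simp add: columnwise_def)
  ultimately have "bij_betw ((\<lambda>q. X0 (q * n + c)) \<circ> ?p) {..<h} {..<h}" by (rule bij_betw_trans)
  then show "bij_betw (\<lambda>q. X (q * n + c)) {..<h} {..<h}"
    by (rule bij_betw_cong[THEN iffD1, rotated]) (use tr c in \<open>simp add: trail_def\<close>)
qed

text \<open>At \<open>j\<close> one unit passes from \<open>r\<close> to \<open>s\<close> across a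
  gap of at least 2, which strictly lowers the sum of squares. At \<open>k\<close> one unit passes
  from \<open>s\<close> to \<open>r\<close>, and \<open>stop\<close> says that \<open>r\<close> then
  exceeds \<open>s\<close> by at most 1, so the squares do not grow.\<close>

lemma trail_potential:
  assumes tr: "trail X0 r s j X U k" and rs: "r < h" "s < h" "r \<noteq> s" and j: "j < n"
    and start: "count X0 s j + 1 < count X0 r j" and stop: "count X r k \<le> count X s k + 1"
  shows "potential X < potential X0"
proof -
  have U: "U \<subseteq> {..<n}" using tr by (simp add: trail_def)
  let ?a = "occ X U r" and ?b = "occ X U s"
  let ?p = "occ X ({..<n} - U) r" and ?q = "occ X ({..<n} - U) s"
  have cnt: "count X r v = ?a v + ?p v" "count X s v = ?b v + ?q v"
    "count X0 r v = ?b v + ?p v" "count X0 s v = ?a v + ?q v" for v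
    using occ_split[OF U, of X] occ_split[OF U, of X0] trail_occ[OF tr rs(1,2)] rs by simp_all
  have e: "int (?a v) - int (?b v) = of_bool (v = k) - of_bool (v = j)" for v
    using tr by (simp add: trail_def)
  \<comment> \<open>A closed trail leaves the multiplicities at \<open>j\<close> as they were,
    contradicting \<open>stop\<close>.\<close>
  have "k \<noteq> j" using e[of j] cnt[of j] start stop by auto
  then have ej: "?b j = Suc (?a j)" and ek: "?a k = Suc (?b k)" using e[of j] e[of k] by auto
  have lej: "(count X r j)\<^sup>2 + (count X s j)\<^sup>2 < (count X0 r j)\<^sup>2 + (count X0 s j)\<^sup>2"
    using start ej unfolding cnt by (simp add: power2_eq_square algebra_simps)
  have le: "(count X r v)\<^sup>2 + (count X s v)\<^sup>2 \<le> (count X0 r v)\<^sup>2 + (count X0 s v)\<^sup>2" for v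
  proof -
    consider "v = j" | "v = k" | "v \<noteq> j" "v \<noteq> k" by blast
    then show ?thesis
    proof cases
      case 1
      then show ?thesis using lej by simp
    next
      case 2
      then show ?thesis using stop ek unfolding cnt by (simp add: power2_eq_square algebra_simps)
    next
      case 3
      then have "?a v = ?b v" using e[of v] by simp
      then show ?thesis unfolding cnt by simp
    qed
  qed
  have lt: "(\<Sum>v<n. (count X r v)\<^sup>2 + (count X s v)\<^sup>2) < (\<Sum>v<n. (count X0 r v)\<^sup>2 + (count X0 s v)\<^sup>2)"
    by (rule sum_strict_mono_ex1) (use le lej j in auto)
  have split: "potential Y = (\<Sum>v<n. (count Y r v)\<^sup>2 + (count Y s v)\<^sup>2) +
      (\<Sum>q\<in>{..<h} - {r} - {s}. \<Sum>v<n. (count Y q v)\<^sup>2)" for Y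
    unfolding potential_def using rs
    by (simp add: sum.remove[of "{..<h}" r] sum.remove[of "{..<h} - {r}" s] sum.distrib)
  have "(\<Sum>q\<in>{..<h} - {r} - {s}. \<Sum>v<n. (count X q v)\<^sup>2) =
      (\<Sum>q\<in>{..<h} - {r} - {s}. \<Sum>v<n. (count X0 q v)\<^sup>2)"
    by (rule sum.cong) (use trail_occ(4)[OF tr rs(1,2)] in auto)
  with lt show ?thesis unfolding split by simp
qed

lemma count_le: "count X r v \<le> n"
proof -
  have "occ X {..<n} r v \<le> card {..<n}" unfolding occ_def by (rule card_mono) auto
  then show ?thesis by simp
qed

lemma potential_le: "potential X \<le> (h * n) * (n * n)"
proof -
  have "potential X \<le> (\<Sum>r<h. \<Sum>v<n. n\<^sup>2)"
    unfolding potential_def using count_le by (intro sum_mono power_mono) auto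
  then show ?thesis by (simp add: power2_eq_square)
qed

lemma count_eq_sum: "count X r v = (\<Sum>c<n. of_bool (target X r c = v))"
proof -
  have "{c \<in> {..<n}. target X r c = v} = {..<n} \<inter> {c. target X r c = v}" by auto
  then show ?thesis unfolding occ_def by simp
qed

text \<open>The \<open>h\<close> multiplicities of a target column sum to \<open>h\<close>. If one
  were 0, all would be at most 1 and the sum too small; so all are positive, and one above 1 would
  make the sum too large.\<close>

lemma balanced_imp_distinct:
  assumes X: "columnwise X"
    and regular: "\<And>v. v < n \<Longrightarrow> (\<Sum>c<n. \<Sum>x<h. of_bool (T (x * n + c) = v)) = h"
    and balanced: "\<And>r s v. r < h \<Longrightarrow> s < h \<Longrightarrow> v < n \<Longrightarrow> count X r v \<le> count X s v + 1"
    and r: "r < h"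
  shows "inj_on (target X r) {..<n}"
proof (rule inj_onI)
  fix c c' assume c: "c \<in> {..<n}" "c' \<in> {..<n}" "target X r c = target X r c'"
  let ?v = "target X r c"
  have "X (r * n + c) < h" using X r c(1) unfolding columnwise_def by (auto dest: bij_betwE)
  then have v: "?v < n" using c(1) unfolding target_def by (intro T_less cell_less) auto
  \<comment> \<open>Double counting: within a column the colouring only permutes the tokens, so the
    total number of tokens with target \<open>?v\<close> is that of the input.\<close>
  have "(\<Sum>q<h. count X q ?v) = (\<Sum>c<n. \<Sum>q<h. of_bool (target X q c = ?v))"
    unfolding count_eq_sum by (rule sum.swap)
  also have "\<dots> = (\<Sum>c<n. \<Sum>x<h. of_bool (T (x * n + c) = ?v))"
  proof (rule sum.cong[OF refl])
    fix c assume "c \<in> {..<n}"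
    then have "bij_betw (\<lambda>q. X (q * n + c)) {..<h} {..<h}" using X by (simp add: columnwise_def)
    from sum.reindex_bij_betw[OF this, of "\<lambda>x. of_bool (T (x * n + c) = ?v)"]
    show "(\<Sum>q<h. of_bool (target X q c = ?v)) = (\<Sum>x<h. of_bool (T (x * n + c) = ?v))"
      by (simp only: target_def[of X _ c])
  qed
  also have "\<dots> = h" by (rule regular[OF v])
  finally have sum: "(\<Sum>q<h. count X q ?v) = h" .
  have pos: "1 \<le> count X s ?v" if s: "s < h" for s
  proof (rule ccontr)
    assume "\<not> 1 \<le> count X s ?v"
    then have "count X s ?v = 0" by simp
    then have "(\<Sum>q<h. count X q ?v) < (\<Sum>q<h. 1)"
      using balanced[OF _ s v] s by (intro sum_strict_mono_ex1) force+
    then show False using sum by simp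
  qed
  have "count X r ?v \<le> 1"
  proof (rule ccontr)
    assume "\<not> count X r ?v \<le> 1"
    then have "(\<Sum>q<h. 1) < (\<Sum>q<h. count X q ?v)"
      using pos r by (intro sum_strict_mono_ex1) force+
    then show False using sum by simp
  qed
  then show "c = c'" using c unfolding occ_def by (auto simp: card_le_Suc0_iff_eq)
qed

end

section \<open>The colouring program\<close>

abbreviation seq (infixr ";;" 60) where "c1 ;; c2 \<equiv> Seq c1 c2"
abbreviation If_then :: "bexp \<Rightarrow> com \<Rightarrow> com" where "If_then b c \<equiv> Cond b c Skip"
abbreviation Inc :: "name \<Rightarrow> com" where "Inc x \<equiv> Set x (Plus (Var x) (Lit 1))"
abbreviation Cell :: "name \<Rightarrow> aexp \<Rightarrow> aexp \<Rightarrow> aexp" where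
  "Cell x r c \<equiv> Read x (Plus (Read ''off'' r) c)"
abbreviation Target :: "aexp \<Rightarrow> aexp \<Rightarrow> aexp" where
  "Target r c \<equiv> Cell ''T'' (Cell ''X'' r c) c"

lemmas wp_intros = wp_Seq wp_Cond wp_Write wp_Skip

definition count_prog :: com where
  "count_prog = Set ''ca'' (Lit 0) ;; Set ''cb'' (Lit 0) ;; For ''c'' ''n'' (
     If_then (Equal (Target (Var ''r'') (Var ''c'')) (Var ''k'')) (Inc ''ca'') ;;
     If_then (Equal (Target (Var ''s'') (Var ''c'')) (Var ''k'')) (Inc ''cb''))"

text \<open>The loop runs to the end and keeps the last candidate; any unreversed arc leaving
  \<open>k\<close> will do.\<close>

definition search_prog :: com where
  "search_prog = For ''c'' ''n'' (If_then
     (Conj (Equal (Read ''used'' (Var ''c'')) (Lit 0)) (Equal (Target (Var ''r'') (Var ''c'')) (Var ''k'')))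
     (Set ''d'' (Var ''c'')))"

text \<open>\<open>k\<close> is read after the exchange, when row \<open>r\<close> of column
  \<open>d\<close> already holds the token at the head of the old arc.\<close>

definition step_prog :: com where
  "step_prog = search_prog ;; Write ''used'' (Var ''d'') (Lit 1) ;;
     Set ''e'' (Cell ''X'' (Var ''r'') (Var ''d'')) ;;
     Write ''X'' (Plus (Read ''off'' (Var ''r'')) (Var ''d'')) (Cell ''X'' (Var ''s'') (Var ''d'')) ;;
     Write ''X'' (Plus (Read ''off'' (Var ''s'')) (Var ''d'')) (Var ''e'') ;;
     Set ''k'' (Target (Var ''r'') (Var ''d'')) ;; count_prog"

definition balance_prog :: com where
  "balance_prog = Set ''k'' (Var ''j'') ;; count_prog ;;
     If_then (Less (Plus (Var ''cb'') (Lit 1)) (Var ''ca'')) (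
       Set ''flag'' (Lit 1) ;; For ''c'' ''n'' (Write ''used'' (Var ''c'') (Lit 0)) ;;
       While (Less (Plus (Var ''cb'') (Lit 1)) (Var ''ca'')) step_prog)"

definition pass_prog :: com where
  "pass_prog = Set ''flag'' (Lit 0) ;; For ''r'' ''h'' (For ''s'' ''h'' (For ''j'' ''n'' balance_prog))"

text \<open>If \<open>flag\<close> stays 0 during a pass, all triples were tested against the same
  \<open>X\<close>, so this \<open>X\<close> is balanced.\<close>

definition rows_prog :: com where
  "rows_prog = Set ''flag'' (Lit 1) ;; While (Equal (Var ''flag'') (Lit 1)) pass_prog"

lemma writes_count_prog [simp]: "writes count_prog = {''ca'', ''cb'', ''c''}"
  by (auto simp: count_prog_def)

lemma writes_search_prog [simp]: "writes search_prog = {''d'', ''c''}"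
  by (auto simp: search_prog_def)

lemma writes_step_prog [simp]:
  "writes step_prog = {''ca'', ''cb'', ''c'', ''d'', ''e'', ''k'', ''used'', ''X''}"
  by (auto simp: step_prog_def)

lemma writes_balance_prog [simp]:
  "writes balance_prog = {''flag'', ''ca'', ''cb'', ''c'', ''d'', ''e'', ''k'', ''used'', ''X''}"
  by (auto simp: balance_prog_def)

lemma writes_pass_prog [simp]: "writes pass_prog =
    {''r'', ''s'', ''j'', ''flag'', ''ca'', ''cb'', ''c'', ''d'', ''e'', ''k'', ''used'', ''X''}"
  by (auto simp: pass_prog_def)

lemma writes_rows_prog [simp]: "writes rows_prog =
    {''r'', ''s'', ''j'', ''flag'', ''ca'', ''cb'', ''c'', ''d'', ''e'', ''k'', ''used'', ''X''}"
  by (auto simp: rows_prog_def)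

text \<open>The bounds on \<open>B\<close> are for loops over rows, columns, cells, and passes of
  the local search; the last is the largest potential plus 1 for the final pass.\<close>

locale grid_prog = column_targets h n T for h n T +
  fixes R :: "nat \<Rightarrow> nat" and B :: nat
  assumes B: "h \<le> B" "n \<le> B" "h * n \<le> B" "(h * n) * (n * n) + 1 \<le> B"
begin

text \<open>The tables \<open>off\<close>, \<open>row\<close>, \<open>col\<close> and
  \<open>par\<close> stand for multiplication by \<open>n\<close>, quotient, remainder and parity,
  none of which is an operation of the machine.\<close>

definition base :: "state \<Rightarrow> bool" where
  "base s \<longleftrightarrow> s ''h'' 0 = h \<and> s ''n'' 0 = n \<and> s ''N'' 0 = h * n \<and> (\<forall>r<h. s ''off'' r = r * n) \<and>
     (\<forall>i<h * n. s ''row'' i = i div n \<and> s ''col'' i = i mod n \<and> s ''T'' i = T i \<and> s ''R'' i = R i) \<and>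
     (\<forall>i\<le>h * n. s ''par'' i = i mod 2)"

lemma base_cong:
  assumes "base s"
    and "s' ''h'' = s ''h''" "s' ''n'' = s ''n''" "s' ''N'' = s ''N''" "s' ''off'' = s ''off''"
    "s' ''row'' = s ''row''" "s' ''col'' = s ''col''" "s' ''T'' = s ''T''" "s' ''R'' = s ''R''"
    "s' ''par'' = s ''par''"
  shows "base s'"
  using assms by (simp add: base_def)

lemma aval_Target:
  assumes "base s" "columnwise (s ''X'')" "aval e s < h" "aval f s < n"
  shows "aval (Target e f) s = target (s ''X'') (aval e s) (aval f s)"
proof -
  have "s ''X'' (aval e s * n + aval f s) < h"
    using assms unfolding columnwise_def by (auto dest: bij_betwE)
  then show ?thesis using assms cell_less by (simp add: base_def target_def)
qed

lemma target_less: "columnwise X \<Longrightarrow> r < h \<Longrightarrow> c < n \<Longrightarrow> target X r c < n"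
  unfolding target_def columnwise_def by (intro T_less cell_less) (auto dest: bij_betwE)

lemma occ_Suc: "occ X {..<Suc m} r v = occ X {..<m} r v + of_bool (target X r m = v)"
proof -
  have "{c \<in> {..<Suc m}. target X r c = v} =
    (if target X r m = v then insert m {c \<in> {..<m}. target X r c = v}
     else {c \<in> {..<m}. target X r c = v})" by (auto simp: less_Suc_eq)
  then show ?thesis by (simp add: occ_def)
qed

lemma wp_count_prog:
  assumes "base s" "columnwise (s ''X'')" "s ''r'' 0 < h" "s ''s'' 0 < h"
  shows "wp B count_prog (\<lambda>s'. s' ''ca'' 0 = count (s ''X'') (s ''r'' 0) (s ''k'' 0) \<and>
    s' ''cb'' 0 = count (s ''X'') (s ''s'' 0) (s ''k'' 0)) s"
  unfolding count_prog_def
proof (intro wp_intros, rule wp_For[where I =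
    "\<lambda>m s'. s' ''ca'' 0 = occ (s ''X'') {..<m} (s ''r'' 0) (s ''k'' 0) \<and>
       s' ''cb'' 0 = occ (s ''X'') {..<m} (s ''s'' 0) (s ''k'' 0)"], goal_cases)
  case (6 m s')
  then show ?case by simp
next
  case (7 m s')
  have fr: "s' y = s y" if "y \<notin> {''ca'', ''cb'', ''c''}" for y using 7(4)[of y] that by simp
  have b: "base s'" "base (s'(''ca'' := f))" for f by (rule base_cong[OF assms(1)]; simp add: fr)+
  have m: "m < n" using 7(2) assms(1) by (simp add: base_def)
  have v: "s' ''r'' = s ''r''" "s' ''s'' = s ''s''" "s' ''X'' = s ''X''" "s' ''k'' = s ''k''" by (rule fr, simp)+
  have t: "aval (Target (Var ''r'') (Var ''c'')) s' = target (s ''X'') (s ''r'' 0) m"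
    "aval (Target (Var ''s'') (Var ''c'')) s' = target (s ''X'') (s ''s'' 0) m"
    "aval (Target (Var ''s'') (Var ''c'')) (s'(''ca'' := f)) = target (s ''X'') (s ''s'' 0) m" for f
    using b m v assms 7(3) by (subst aval_Target; simp)+
  show ?case
    by (intro wp_intros)
      (use 7(1) in \<open>simp_all only: bval.simps t, simp_all add: v occ_Suc\<close>)
next
  case (8 s')
  then show ?case using assms(1) by (simp add: base_def)
qed (use B assms(1) in \<open>simp_all add: occ_def base_def\<close>)

lemma wp_search_prog:
  assumes "base s" "columnwise (s ''X'')" "s ''r'' 0 < h"
    and ex: "\<exists>c<n. s ''used'' c = 0 \<and> target (s ''X'') (s ''r'' 0) c = s ''k'' 0"
  shows "wp B search_prog (\<lambda>s'. s' ''d'' 0 < n \<and> s ''used'' (s' ''d'' 0) = 0 \<and>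
    target (s ''X'') (s ''r'' 0) (s' ''d'' 0) = s ''k'' 0) s"
  unfolding search_prog_def
\<comment> \<open>The invariant is vacuous before the first candidate is met, because
  \<open>d\<close> may hold an old value until then.\<close>
proof (rule wp_For[where I =
    "\<lambda>m s'. (\<exists>c<m. s ''used'' c = 0 \<and> target (s ''X'') (s ''r'' 0) c = s ''k'' 0) \<longrightarrow>
      s' ''d'' 0 < n \<and> s ''used'' (s' ''d'' 0) = 0 \<and>
      target (s ''X'') (s ''r'' 0) (s' ''d'' 0) = s ''k'' 0"], goal_cases)
  case (6 m s')
  then show ?case by simp
next
  case (7 m s')
  have fr: "s' y = s y" if "y \<notin> {''d'', ''c''}" for y using 7(4)[of y] that by simp
  have b: "base s'" by (rule base_cong[OF assms(1)]) (simp_all add: fr)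
  have m: "m < n" using 7(2) assms(1) by (simp add: base_def)
  have v: "s' ''r'' = s ''r''" "s' ''X'' = s ''X''" "s' ''k'' = s ''k''" "s' ''used'' = s ''used''"
    by (rule fr, simp)+
  have t: "aval (Target (Var ''r'') (Var ''c'')) s' = target (s ''X'') (s ''r'' 0) m"
    using b m v assms 7(3) by (subst aval_Target; simp)
  show ?case
    by (intro wp_intros)
      (use 7(1,3) m in \<open>simp_all only: bval.simps t, auto simp: v less_Suc_eq\<close>)
next
  case (8 s')
  then show ?case using assms(1) ex by (simp add: base_def)
qed (use B assms(1) in \<open>simp_all add: base_def\<close>)

definition used :: "state \<Rightarrow> nat set" where
  "used s = {c. c < n \<and> s ''used'' c \<noteq> 0}"

definition walking :: "nat \<Rightarrow> nat \<Rightarrow> nat \<Rightarrow> (nat \<Rightarrow> nat) \<Rightarrow> state \<Rightarrow> bool" where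
  "walking r s j X0 st \<longleftrightarrow> columnwise (st ''X'') \<and> trail X0 r s j (st ''X'') (used st) (st ''k'' 0) \<and>
     st ''ca'' 0 = count (st ''X'') r (st ''k'' 0) \<and> st ''cb'' 0 = count (st ''X'') s (st ''k'' 0)"

text \<open>Each step marks a fresh column, so the number of unmarked columns is a measure for the
  walk.\<close>

lemma wp_step_prog:
  assumes b: "base st" and rs: "st ''r'' 0 = r" "st ''s'' 0 = s" "r < h" "s < h" "r \<noteq> s"
    and w: "walking r s j X0 st" and X0: "columnwise X0" and g: "st ''cb'' 0 + 1 < st ''ca'' 0"
  shows "wp B step_prog (\<lambda>st'. walking r s j X0 st' \<and> n - card (used st') < n - card (used st)) st"
  unfolding step_prog_def
proof (intro wp_intros, rule wp_frame[OF wp_search_prog[OF b]], goal_cases)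
  case 1
  then show ?case using w by (simp add: walking_def)
next
  case 2
  then show ?case using rs by simp
next
  case 3
  then show ?case using trail_next[of X0 r s j "st ''X''" "used st" "st ''k'' 0"] w g rs
    by (auto simp: walking_def used_def)
next
  case (4 s1)
  define d where "d = s1 ''d'' 0"
  have fr: "s1 y = st y" if "y \<notin> {''d'', ''c''}" for y using 4(2)[of y] that by simp
  have v: "s1 ''r'' = st ''r''" "s1 ''s'' = st ''s''" "s1 ''X'' = st ''X''" "s1 ''k'' = st ''k''"
    "s1 ''used'' = st ''used''" "s1 ''off'' = st ''off''" "s1 ''T'' = st ''T''" by (rule fr, simp)+
  have off: "st ''off'' r = r * n" "st ''off'' s = s * n" using b rs by (simp_all add: base_def)
  have d: "d < n" "d \<notin> used st" "target (st ''X'') r d = st ''k'' 0"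
    using 4(1) rs by (simp_all add: used_def d_def)
  let ?X = "exchange r s d (st ''X'')"
  have cw: "columnwise (st ''X'')" and tr: "trail X0 r s j (st ''X'') (used st) (st ''k'' 0)"
    using w by (simp_all add: walking_def)
  have tr': "trail X0 r s j ?X (insert d (used st)) (target (st ''X'') s d)"
    by (rule trail_step[OF tr rs(3-5) d]) (rule target_less[OF cw rs(4) d(1)])
  have cw': "columnwise ?X" by (rule trail_columnwise[OF tr' rs(3,4) X0])
  have ne: "r * n + d \<noteq> s * n + d" using rs(5) d(1) by (simp add: cell_eq_iff)
  \<comment> \<open>Links the value that the program reads after the exchange to the endpoint named
    by \<open>trail_step\<close>.\<close>
  have tg: "target ?X r d = target (st ''X'') s d"
    using ne by (simp add: target_def exchange_def)
  define s2 where "s2 = s1(''used'' := (st ''used'')(d := 1), ''e'' := (s1 ''e'')(0 := st ''X'' (r * n + d)), ''X'' := ?X)"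
  have b2: "base s2" by (rule base_cong[OF b]) (simp_all add: fr s2_def)
  have kv: "st ''T'' (st ''off'' (st ''X'' (s * n + d)) + d) = target (st ''X'') s d"
    using aval_Target[OF b cw, of "Lit s" "Lit d"] rs d(1) off by simp
  define s3 where "s3 = s2(''k'' := (st ''k'')(0 := target (st ''X'') s d))"
  have b3: "base s3" by (rule base_cong[OF b2]) (simp_all add: s3_def)
  have u3: "used s3 = insert d (used st)"
    using d(1) by (auto simp: used_def s3_def s2_def)
  have v3: "s3 ''X'' = ?X" "s3 ''k'' 0 = target (st ''X'') s d" "s3 ''r'' 0 = r" "s3 ''s'' 0 = s"
    using v rs by (simp_all add: s3_def s2_def)
  have fin: "card (insert d (used st)) = Suc (card (used st))" "card (insert d (used st)) \<le> n"
  proof -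
    have "insert d (used st) \<subseteq> {..<n}" using d(1) by (auto simp: used_def)
    then show "card (insert d (used st)) \<le> n" using card_mono[of "{..<n}"] by fastforce
    have "finite (used st)" by (simp add: used_def)
    then show "card (insert d (used st)) = Suc (card (used st))" using d(2) by simp
  qed
  have "wp B count_prog (\<lambda>st'. walking r s j X0 st' \<and> n - card (used st') < n - card (used st)) s3"
  proof (rule wp_frame[OF wp_count_prog[OF b3]], goal_cases)
    case (4 s4)
    have fr4: "s4 y = s3 y" if "y \<notin> {''ca'', ''cb'', ''c''}" for y using 4(2)[of y] that by simp
    have v4: "s4 ''X'' = ?X" "s4 ''k'' 0 = target (st ''X'') s d" "s4 ''used'' = s3 ''used''"
      using v3 fr4[of "''X''"] fr4[of "''k''"] fr4[of "''used''"] by simp_all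
    have u4: "used s4 = insert d (used st)" using u3 v4(3) by (simp add: used_def)
    have "walking r s j X0 s4"
      unfolding walking_def u4 v4 using 4(1) tr' cw' v3 by simp
    then show ?case using fin u4 by simp
  qed (use cw' v3 rs in simp_all)
  moreover have "s3 = s1(''used'' := (st ''used'')(d := 1), ''e'' := (s1 ''e'')(0 := st ''X'' (r * n + d)),
      ''X'' := (st ''X'')(r * n + d := st ''X'' (s * n + d), s * n + d := st ''X'' (r * n + d)),
      ''k'' := (st ''k'')(0 := target (st ''X'') s d))"
    by (simp add: s3_def s2_def exchange_def)
  ultimately show ?case
    using d(1) rs(5) by (intro wp_intros) (simp add: v d_def[symmetric] rs off kv)
qed

lemma wp_balance_prog:
  assumes b: "base st" and cw: "columnwise (st ''X'')"
    and rs: "st ''r'' 0 = r" "st ''s'' 0 = s" "r < h" "s < h" and j: "st ''j'' 0 = j" "j < n"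
  shows "wp B balance_prog (\<lambda>st'.
    st' ''X'' = st ''X'' \<and> st' ''flag'' = st ''flag'' \<and> count (st ''X'') r j \<le> count (st ''X'') s j + 1 \<or>
    st' ''flag'' 0 = 1 \<and> potential (st' ''X'') < potential (st ''X'') \<and> columnwise (st' ''X'')) st"
  (is "wp B _ ?Q st")
  unfolding balance_prog_def
proof (rule wp_Seq, rule wp_Write, rule wp_Seq, rule wp_frame[OF wp_count_prog], goal_cases)
  case 1
  show ?case by (rule base_cong[OF b]) simp_all
next
  case (5 s1)
  let ?X0 = "st ''X''"
  have fr: "s1 y = st y" if "y \<notin> {''k'', ''ca'', ''cb'', ''c''}" for y using 5(2)[of y] that by simp
  have k: "s1 ''k'' 0 = j" using 5(2)[of "''k''"] j by simp
  have cab: "s1 ''ca'' 0 = count ?X0 r j" "s1 ''cb'' 0 = count ?X0 s j" using 5(1) rs j by simp_all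
  show ?case
  proof (rule wp_Cond)
    assume "\<not> bval (Less (Plus (Var ''cb'') (Lit 1)) (Var ''ca'')) s1"
    then show "wp B Skip ?Q s1" using cab by (intro wp_Skip) (simp add: fr)
  next
    assume big: "bval (Less (Plus (Var ''cb'') (Lit 1)) (Var ''ca'')) s1"
    then have rs': "r \<noteq> s" using cab by auto
    let ?I = "\<lambda>m s'. \<forall>c<m. s' ''used'' c = 0"
    let ?V = "{''flag'', ''ca'', ''cb'', ''c'', ''d'', ''e'', ''k'', ''used'', ''X''}"
    show "wp B (Set ''flag'' (Lit 1) ;; For ''c'' ''n'' (Write ''used'' (Var ''c'') (Lit 0)) ;;
       While (Less (Plus (Var ''cb'') (Lit 1)) (Var ''ca'')) step_prog) ?Q s1"
    proof (rule wp_Seq, rule wp_Write, rule wp_Seq, rule wp_For[where I = ?I], goal_cases)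
      case 2
      then show ?case using b B by (simp add: fr base_def)
    next
      case (7 m s')
      then show ?case by (intro wp_Write) (auto simp: less_Suc_eq)
    next
      case (8 s2)
      have fr2: "s2 y = s1 y" if "y \<notin> {''flag'', ''c'', ''used''}" for y using 8(2)[of y] that by simp
      have flag2: "s2 ''flag'' 0 = 1" using 8(2)[of "''flag''"] by simp
      have b2: "base s2" by (rule base_cong[OF b]) (simp_all add: fr fr2)
      have "used s2 = {}" using 8(1) b by (auto simp: used_def fr base_def)
      then have w2: "walking r s j ?X0 s2"
        using cab cw trail_refl[OF j(2)] k by (simp add: walking_def fr fr2)
      show ?case
      proof (rule wp_While[where I = "walking r s j ?X0" and m = "\<lambda>s'. n - card (used s')"], goal_cases)
        case 1
        show ?case by (rule w2)
      next
        case 2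
        then show ?case using B(2) by simp
      next
        case (3 s')
        have fr3: "s' y = st y" if "y \<notin> ?V" for y using 3(3)[of y] that by (simp add: fr fr2)
        have "base s'" by (rule base_cong[OF b]) (simp_all add: fr3)
        then show ?case using 3(1,2) rs rs' cw by (intro wp_step_prog) (simp_all add: fr3)
      next
        case (4 s')
        have "trail ?X0 r s j (s' ''X'') (used s') (s' ''k'' 0)" using 4(1) by (simp add: walking_def)
        then have "potential (s' ''X'') < potential ?X0"
          using 4(1,2) big cab by (intro trail_potential[OF _ rs(3,4) rs' j(2)]) (simp_all add: walking_def not_less)
        moreover have "s' ''flag'' 0 = 1" using 4(3)[of "''flag''"] flag2 by simp
        ultimately show ?case using 4(1) by (simp add: walking_def)
      qed
    qed simp_all
  qed
qed (use cw rs in simp_all)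

definition balanced :: "(nat \<Rightarrow> nat) \<Rightarrow> (nat \<times> nat \<times> nat) set \<Rightarrow> bool" where
  "balanced X Z \<longleftrightarrow> (\<forall>(r, s, v)\<in>Z. count X r v \<le> count X s v + 1)"

text \<open>After the first exchange of a pass the tests recorded in \<open>Z\<close> are void, and
  only the decrease of the potential is remembered.\<close>

definition passing :: "(nat \<Rightarrow> nat) \<Rightarrow> (nat \<times> nat \<times> nat) set \<Rightarrow> state \<Rightarrow> bool" where
  "passing X0 Z st \<longleftrightarrow> columnwise (st ''X'') \<and>
     (st ''flag'' 0 = 1 \<and> potential (st ''X'') < potential X0 \<or>
      st ''flag'' 0 = 0 \<and> st ''X'' = X0 \<and> balanced X0 Z)"

lemma passing_mono: "passing X0 Z st \<Longrightarrow> Z' \<subseteq> Z \<Longrightarrow> passing X0 Z' st"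
  unfolding passing_def balanced_def by blast

lemma passing_upd [simp]: "x \<noteq> ''X'' \<Longrightarrow> x \<noteq> ''flag'' \<Longrightarrow> passing X0 Z (st(x := f)) = passing X0 Z st"
  by (simp add: passing_def)

lemma wp_balance_passing:
  assumes p: "passing X0 Z st" and b: "base st"
    and rs: "st ''r'' 0 = r" "st ''s'' 0 = s" "r < h" "s < h" and j: "st ''j'' 0 = j" "j < n"
  shows "wp B balance_prog (passing X0 (insert (r, s, j) Z)) st"
proof (rule wp_frame[OF wp_balance_prog[OF b _ rs j]])
  show "columnwise (st ''X'')" using p by (simp add: passing_def)
  fix st'
  assume "st' ''X'' = st ''X'' \<and> st' ''flag'' = st ''flag'' \<and> count (st ''X'') r j \<le> count (st ''X'') s j + 1 \<or>
    st' ''flag'' 0 = 1 \<and> potential (st' ''X'') < potential (st ''X'') \<and> columnwise (st' ''X'')"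
  then show "passing X0 (insert (r, s, j) Z) st'"
    using p unfolding passing_def by (elim disjE conjE) (simp_all add: balanced_def)
qed

text \<open>The three nested invariants record the triples that precede the current one
  lexicographically.\<close>

lemma wp_pass_prog:
  assumes b: "base st" and cw: "columnwise (st ''X'')"
  shows "wp B pass_prog (passing (st ''X'') ({..<h} \<times> {..<h} \<times> {..<n})) st"
  unfolding pass_prog_def
proof (rule wp_Seq, rule wp_Write,
    rule wp_For[where I = "\<lambda>r. passing (st ''X'') ({..<r} \<times> {..<h} \<times> {..<n})"], goal_cases)
  case 1
  then show ?case using cw by (simp add: passing_def balanced_def)
next
  case 2
  then show ?case using b B by (simp add: base_def)
next
  case (7 r s1)
  let ?V = "{''flag'', ''ca'', ''cb'', ''c'', ''d'', ''e'', ''k'', ''used'', ''X'', ''s'', ''j'', ''r''}"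
  have fr1: "s1 y = st y" if "y \<notin> ?V" for y using 7(4)[of y] that by simp
  have r: "r < h" using 7(2) b by (simp add: base_def)
  let ?Z = "{..<r} \<times> {..<h} \<times> {..<n}"
  show ?case
  proof (rule wp_For[where I = "\<lambda>s. passing (st ''X'') (?Z \<union> {r} \<times> {..<s} \<times> {..<n})"], goal_cases)
    case 1
    then show ?case using 7(1) by simp
  next
    case 2
    then show ?case using b B by (simp add: base_def fr1)
  next
    case (7 s s2)
    note fr2 = 7(4)
    have s: "s < h" using 7(2) b by (simp add: base_def fr1)
    show ?case
    proof (rule wp_For[where I = "\<lambda>j. passing (st ''X'') (?Z \<union> {r} \<times> {..<s} \<times> {..<n} \<union> {r} \<times> {s} \<times> {..<j})"],
        goal_cases)
      case 1
      then show ?case using 7(1) by simp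
    next
      case 2
      then show ?case using b B by (simp add: base_def fr1 fr2)
    next
      case (7 j s3)
      have j: "j < n" using 7(2) b by (simp add: base_def fr1 fr2)
      have b3: "base s3" by (rule base_cong[OF b]) (simp_all add: fr1 fr2 7(4))
      have v: "s3 ''r'' 0 = r" "s3 ''s'' 0 = s" using \<open>s1 ''r'' 0 = r\<close> \<open>s2 ''s'' 0 = s\<close>
        by (simp_all add: fr2 7(4))
      let ?Z' = "\<lambda>j. ?Z \<union> {r} \<times> {..<s} \<times> {..<n} \<union> {r} \<times> {s} \<times> {..<j}"
      have sub: "?Z' (Suc j) \<subseteq> insert (r, s, j) (?Z' j)" by (auto simp: less_Suc_eq)
      show ?case
        by (rule wp_frame[OF wp_balance_passing[OF 7(1) b3 v r s 7(3) j]]) (rule passing_mono[OF _ sub])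
    next
      case (8 s3)
      show ?case using b by (intro passing_mono[OF 8(1)]) (auto simp: less_Suc_eq base_def fr1 fr2)
    qed simp_all
  next
    case (8 s2)
    show ?case using b by (intro passing_mono[OF 8(1)]) (auto simp: less_Suc_eq base_def fr1)
  qed simp_all
next
  case (8 s1)
  show ?case using b by (intro passing_mono[OF 8(1)]) (auto simp: base_def)
qed simp_all

text \<open>The last pass keeps the potential but turns \<open>flag\<close> from 1 to 0; adding the
  flag to the measure makes this pass decreasing as well.\<close>

lemma wp_rows_prog:
  assumes b: "base st" and cw: "columnwise (st ''X'')"
  shows "wp B rows_prog (\<lambda>st'. columnwise (st' ''X'') \<and> balanced (st' ''X'') ({..<h} \<times> {..<h} \<times> {..<n})) st"
  unfolding rows_prog_def
proof (rule wp_Seq, rule wp_Write, rule wp_While[where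
      I = "\<lambda>st. columnwise (st ''X'') \<and> (st ''flag'' 0 = 1 \<or> st ''flag'' 0 = 0 \<and>
        balanced (st ''X'') ({..<h} \<times> {..<h} \<times> {..<n}))"
      and m = "\<lambda>st. potential (st ''X'') + st ''flag'' 0"], goal_cases)
  case 1
  then show ?case using cw by simp
next
  case 2
  then show ?case using B potential_le[of "st ''X''"] by simp
next
  case (3 s)
  have fr: "s y = st y" if "y \<notin> insert ''flag'' (writes pass_prog)" for y using 3(3)[of y] that by simp
  have b': "base s" by (rule base_cong[OF b]) (simp_all add: fr)
  have flag: "s ''flag'' 0 = 1" using 3(2) by simp
  show ?case
  proof (rule wp_frame[OF wp_pass_prog[OF b']])
    show "columnwise (s ''X'')" using 3(1) by simp
    fix s'
    assume "passing (s ''X'') ({..<h} \<times> {..<h} \<times> {..<n}) s'"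
    then show "(columnwise (s' ''X'') \<and> (s' ''flag'' 0 = 1 \<or> s' ''flag'' 0 = 0 \<and>
        balanced (s' ''X'') ({..<h} \<times> {..<h} \<times> {..<n}))) \<and>
        potential (s' ''X'') + s' ''flag'' 0 < potential (s ''X'') + s ''flag'' 0"
      using flag unfolding passing_def by (elim conjE disjE) simp_all
  qed
next
  case (4 s)
  then show ?case by fastforce
qed

end

section \<open>The sorting program\<close>

definition partner_prog :: "name \<Rightarrow> name \<Rightarrow> com" where
  "partner_prog P K =
     Cond (Conj (Equal (Read ''par'' (Read P (Var ''a''))) (Var ''p''))
         (Conj (Less (Plus (Read P (Var ''a'')) (Lit 1)) (Var ''len''))
           (Less (Read K (Read ''A'' (Plus (Var ''a'') (Var ''st'')))) (Read K (Read ''A'' (Var ''a''))))))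
       (Write ''B'' (Var ''a'') (Plus (Var ''a'') (Var ''st'')))
       (Cond (Conj (Neg (Equal (Read ''par'' (Read P (Var ''a''))) (Var ''p'')))
           (Conj (Less (Lit 0) (Read P (Var ''a'')))
             (Less (Read K (Read ''A'' (Var ''a''))) (Read K (Read ''A'' (Minus (Var ''a'') (Var ''st'')))))))
         (Write ''B'' (Var ''a'') (Minus (Var ''a'') (Var ''st'')))
         (Write ''B'' (Var ''a'') (Var ''a'')))"

definition emit :: "aexp \<Rightarrow> com" where
  "emit e = Write ''out'' (Var ''outlen'') e ;; Inc ''outlen''"

text \<open>The exchanges of a round are simultaneous, so partners and new contents go to
  \<open>''B''\<close> and \<open>''A2''\<close> before \<open>''A''\<close> is overwritten.\<close>

definition round_prog :: "name \<Rightarrow> name \<Rightarrow> com" where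
  "round_prog P K =
     For ''a'' ''N'' (partner_prog P K) ;;
     For ''a'' ''N'' (emit (Plus (Read ''row'' (Read ''B'' (Var ''a''))) (Lit 1)) ;;
       emit (Plus (Read ''col'' (Read ''B'' (Var ''a''))) (Lit 1)) ;;
       Write ''A2'' (Var ''a'') (Read ''A'' (Read ''B'' (Var ''a'')))) ;;
     For ''a'' ''N'' (Write ''A'' (Var ''a'') (Read ''A2'' (Var ''a'')))"

definition phase_prog :: "name \<Rightarrow> name \<Rightarrow> aexp \<Rightarrow> aexp \<Rightarrow> aexp \<Rightarrow> com" where
  "phase_prog P K st len W = Set ''st'' st ;; Set ''len'' len ;; Set ''W'' W ;; Set ''p'' (Lit 0) ;;
     For ''t'' ''W'' (round_prog P K ;; Set ''p'' (Minus (Lit 1) (Var ''p'')))"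

lemma writes_partner_prog [simp]: "writes (partner_prog P K) = {''B''}"
  by (auto simp: partner_prog_def)

lemma writes_emit [simp]: "writes (emit e) = {''out'', ''outlen''}"
  by (auto simp: emit_def)

lemma writes_round_prog [simp]: "writes (round_prog P K) = {''a'', ''B'', ''A2'', ''A'', ''out'', ''outlen''}"
  by (auto simp: round_prog_def)

lemma writes_phase_prog [simp]: "writes (phase_prog P K st len W) =
    {''st'', ''len'', ''W'', ''p'', ''t'', ''a'', ''B'', ''A2'', ''A'', ''out'', ''outlen''}"
  by (auto simp: phase_prog_def)

lemma output_of_cong: "s' ''out'' = s ''out'' \<Longrightarrow> s' ''outlen'' = s ''outlen'' \<Longrightarrow> output_of s' = output_of s"
  by (simp add: output_of_def)

lemma output_of_upd [simp]: "x \<noteq> ''out'' \<Longrightarrow> x \<noteq> ''outlen'' \<Longrightarrow> output_of (s(x := f)) = output_of s"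
  by (simp add: output_of_def)

lemma output_of_emit: "output_of (s(''out'' := (s ''out'')(s ''outlen'' 0 := v),
    ''outlen'' := (s ''outlen'')(0 := Suc (s ''outlen'' 0)))) = output_of s @ [v]"
  by (simp add: output_of_def)

lemma wp_emit:
  assumes "aval e s = v" and "\<And>f g. output_of (s(''out'' := f, ''outlen'' := g)) = output_of s @ [v] \<Longrightarrow>
    Q (s(''out'' := f, ''outlen'' := g))"
  shows "wp B (emit e) Q s"
  unfolding emit_def
  by (intro wp_intros) (use assms(2) output_of_emit[of s v] assms(1) in simp)

lemma pair_concat_Suc: "concat (map f [0..<Suc k]) = concat (map f [0..<k]) @ f k"
  by simp

text \<open>\<open>P\<close> names the array of positions along a line and \<open>K\<close> the
  array of keys; both are read throughout a phase and must differ from its working arrays. The bound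
  on \<open>m\<close> keeps positions inside the parity table.\<close>

locale grid_phase = grid_prog h n T R B + grid_lines h n l m d pos ln cell
  for h n T R B l m d pos ln cell +
  fixes P K :: name and key :: "nat \<Rightarrow> nat" and C :: "nat \<times> nat \<Rightarrow> nat \<times> nat"
  assumes m_le: "m \<le> h * n"
    and P: "P \<notin> {''st'', ''len'', ''W'', ''p'', ''t'', ''a'', ''B'', ''A2'', ''A'', ''out'', ''outlen''}"
    and K: "K \<notin> {''st'', ''len'', ''W'', ''p'', ''t'', ''a'', ''B'', ''A2'', ''A'', ''out'', ''outlen''}"
begin

definition ready :: "state \<Rightarrow> bool" where
  "ready s \<longleftrightarrow> base s \<and> s ''st'' 0 = d \<and> s ''len'' 0 = m \<and> (\<forall>i<h * n. s P i = pos i) \<and> s K = key"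

lemma ready_cong:
  assumes "ready s"
    and "s' ''st'' = s ''st''" "s' ''len'' = s ''len''" "s' P = s P" "s' K = s K"
    and "s' ''h'' = s ''h''" "s' ''n'' = s ''n''" "s' ''N'' = s ''N''" "s' ''off'' = s ''off''"
    "s' ''row'' = s ''row''" "s' ''col'' = s ''col''" "s' ''T'' = s ''T''" "s' ''R'' = s ''R''"
    "s' ''par'' = s ''par''"
  shows "ready s'"
  using assms by (simp add: ready_def base_def)

lemma wp_partner_prog:
  assumes r: "ready s" and a: "s ''a'' 0 < h * n"
  shows "wp B (partner_prog P K)
    (\<lambda>s'. s' ''B'' = (s ''B'')(s ''a'' 0 := partner (s ''p'' 0) (\<lambda>i. key (s ''A'' i)) (s ''a'' 0))) s"
proof -
  have par: "s ''par'' (pos (s ''a'' 0)) = pos (s ''a'' 0) mod 2"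
    using r a pos_less[OF a] m_le by (simp add: ready_def base_def)
  have v: "s ''st'' 0 = d" "s ''len'' 0 = m" "s P (s ''a'' 0) = pos (s ''a'' 0)" "s K = key"
    using r a by (simp_all add: ready_def)
  show ?thesis unfolding partner_prog_def
    by (intro wp_intros) (auto simp: v par partner_def)
qed

lemma wp_round_prog:
  assumes r: "ready s" and p: "s ''p'' 0 < 2" and em: "emitted h n C k (s ''A'') (output_of s)"
  shows "wp B (round_prog P K) (\<lambda>s'.
    s' ''A'' = (\<lambda>i. if i < h * n then s ''A'' (partner (s ''p'' 0) (\<lambda>i. key (s ''A'' i)) i) else s ''A'' i) \<and>
    emitted h n C (Suc k) (s' ''A'') (output_of s')) s"
proof -
  let ?p = "partner (s ''p'' 0) (\<lambda>i. key (s ''A'' i))"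
  let ?out = "\<lambda>k. concat (map (\<lambda>i. [?p i div n + 1, ?p i mod n + 1]) [0..<k])"
  have N: "s ''N'' 0 = h * n" using r by (simp add: ready_def base_def)
  note pp = partner_props[OF _ p]
  show ?thesis unfolding round_prog_def
  proof (intro wp_Seq, rule wp_For[where I = "\<lambda>j s'. \<forall>i<j. s' ''B'' i = ?p i"], goal_cases)
    case (7 j s1)
    have "ready s1" by (rule ready_cong[OF r]) (use P K 7(4) in simp_all)
    then show ?case
      by (rule wp_frame[OF wp_partner_prog]) (use 7 N in \<open>auto simp: less_Suc_eq\<close>)
  next
    case (8 s1)
    note fr1 = 8(2)
    have B1: "s1 ''B'' i = ?p i" if "i < h * n" for i using 8(1) N that by simp
    show ?case
    proof (rule wp_Seq, rule wp_For[where I =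
        "\<lambda>j s'. output_of s' = output_of s @ ?out j \<and> (\<forall>i<j. s' ''A2'' i = s ''A'' (?p i))"], goal_cases)
      case 1
      have "output_of s1 = output_of s" by (rule output_of_cong) (simp_all add: fr1)
      then show ?case by simp
    next
      case 2
      then show ?case using B N by (simp add: fr1)
    next
      case (7 j s2)
      note fr2 = 7(4)
      have j: "j < h * n" using 7(2) N by (simp add: fr1)
      have rc: "s ''row'' (?p j) = ?p j div n" "s ''col'' (?p j) = ?p j mod n"
        using r pp(1)[OF j] by (simp_all add: ready_def base_def)
      show ?case
        by (intro wp_Seq wp_emit wp_Write)
          (use 7(1) in \<open>auto simp: 7(3) B1[OF j] rc fr1 fr2 pair_concat_Suc less_Suc_eq simp del: upt_Suc\<close>)
    next
      case (8 s2)
      note fr2 = 8(2)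
      have A2: "s2 ''A2'' i = s ''A'' (?p i)" if "i < h * n" for i using 8(1) N that by (simp add: fr1)
      have out2: "output_of s2 = output_of s @ ?out (h * n)" using 8(1) N by (simp add: fr1)
      show ?case
      proof (rule wp_For[where I = "\<lambda>j s'. s' ''A'' = (\<lambda>i. if i < j then s ''A'' (?p i) else s ''A'' i)"],
          goal_cases)
        case 1
        then show ?case by (simp add: fr1 fr2)
      next
        case 2
        then show ?case using B N by (simp add: fr1 fr2)
      next
        case (7 j s3)
        have j: "j < h * n" using 7(2) N by (simp add: fr1 fr2)
        then show ?case
          by (intro wp_Write) (use 7(1,3) A2[OF j] in \<open>auto simp: 7(4) fun_eq_iff less_Suc_eq\<close>)
      next
        case (8 s3)
        have A3: "s3 ''A'' = (\<lambda>i. if i < h * n then s ''A'' (?p i) else s ''A'' i)"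
          using 8(1) N by (simp add: fr1 fr2)
        have "output_of s3 = output_of s2" by (rule output_of_cong) (simp_all add: 8(2))
        moreover have "emitted h n C (Suc k) (s3 ''A'') (output_of s @ ?out (h * n))"
          by (rule emitted_step[OF em]) (use A3 pp in auto)
        ultimately show ?case using A3 out2 by simp
      qed simp_all
    qed simp_all
  qed (use B N in auto)
qed

text \<open>The parameters are evaluated one after another, the later ones after
  \<open>''st''\<close> and \<open>''len''\<close> have been stored. Premise \<open>v\<close>
  therefore ranges over states that differ in these two arrays.\<close>

lemma wp_phase_prog:
  assumes b: "base s" and PK: "\<forall>i<h * n. s P i = pos i" "s K = key"
    and v: "\<And>s'. base s' \<Longrightarrow> (\<And>x. x \<notin> {''st'', ''len''} \<Longrightarrow> s' x = s x) \<Longrightarrow>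
      aval st s' = d \<and> aval len s' = m \<and> aval We s' = W"
    and W: "W \<le> B"
    and em: "emitted h n C k (s ''A'') (output_of s)"
  shows "wp B (phase_prog P K st len We) (\<lambda>s'. s' ''A'' = arrangement key (s ''A'') W \<and>
     emitted h n C (k + W) (s' ''A'') (output_of s')) s"
proof -
  define s1 where "s1 = s(''st'' := (s ''st'')(0 := d), ''len'' := (s ''len'')(0 := m),
    ''W'' := (s ''W'')(0 := W), ''p'' := (s ''p'')(0 := 0))"
  have r1: "ready s1" using b PK P K by (auto simp: s1_def ready_def base_def)
  have "wp B (For ''t'' ''W'' (round_prog P K ;; Set ''p'' (Minus (Lit 1) (Var ''p''))))
    (\<lambda>s'. s' ''A'' = arrangement key (s ''A'') W \<and> emitted h n C (k + W) (s' ''A'') (output_of s')) s1"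
  proof (rule wp_For[where I = "\<lambda>t s'. s' ''p'' 0 = t mod 2 \<and> s' ''A'' = arrangement key (s ''A'') t \<and>
      emitted h n C (k + t) (s' ''A'') (output_of s')"], goal_cases)
    case 1
    then show ?case using em by (simp add: s1_def)
  next
    case 2
    then show ?case using W by (simp add: s1_def)
  next
    case (7 t s2)
    have r2: "ready s2" by (rule ready_cong[OF r1]) (use P K 7(4) in simp_all)
    have p2: "s2 ''p'' 0 = t mod 2" "s2 ''A'' = arrangement key (s ''A'') t"
      "emitted h n C (k + t) (s2 ''A'') (output_of s2)" using 7(1) by blast+
    show ?case
    proof (rule wp_Seq, rule wp_frame[OF wp_round_prog[OF r2 _ p2(3)]])
      show "s2 ''p'' 0 < 2" using p2(1) by simp
    next
      fix s3
      assume s3: "s3 ''A'' = (\<lambda>i. if i < h * n then s2 ''A'' (partner (s2 ''p'' 0) (\<lambda>i. key (s2 ''A'' i)) i)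
        else s2 ''A'' i) \<and> emitted h n C (Suc (k + t)) (s3 ''A'') (output_of s3)"
        and fr: "\<And>x. x \<notin> writes (round_prog P K) \<Longrightarrow> s3 x = s2 x"
      have A: "s3 ''A'' = arrangement key (s ''A'') (Suc t)"
        unfolding arrangement.simps p2(1,2)[symmetric] using s3 by blast
      have E: "emitted h n C (Suc (k + t)) (arrangement key (s ''A'') (Suc t)) (output_of s3)"
        using s3 unfolding A by blast
      have "s3 ''p'' 0 = t mod 2" using fr[of "''p''"] p2(1) by simp
      moreover have "Suc 0 - t mod 2 = Suc t mod 2" by presburger
      ultimately show "wp B (Set ''p'' (Minus (Lit 1) (Var ''p''))) (\<lambda>s'. s' ''p'' 0 = Suc t mod 2 \<and>
          s' ''A'' = arrangement key (s ''A'') (Suc t) \<and> emitted h n C (k + Suc t) (s' ''A'') (output_of s')) s3"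
        by (intro wp_Write) (simp add: A E del: arrangement.simps)
    qed
  next
    case (8 s2)
    have "s1 ''W'' 0 = W" by (simp add: s1_def)
    then show ?case using 8(1) by auto
  qed auto
  moreover have "base (s(''st'' := f))" "base (s(''st'' := f, ''len'' := g))" for f g
    by (rule base_cong[OF b]; simp)+
  then have "aval st s = d" "aval len (s(''st'' := f)) = m" "aval We (s(''st'' := f, ''len'' := g)) = W" for f g
    using v[OF b] v[of "s(''st'' := f)"] v[of "s(''st'' := f, ''len'' := g)"] by simp_all
  ultimately show ?thesis unfolding phase_prog_def
    by (intro wp_intros) (simp add: s1_def)
qed

end

text \<open>\<open>N\<close> runs through the cell numbers and ends as their total, which fills the
  tables by counting alone. Initially every token has its own row as colour.\<close>

definition setup_prog :: com where
  "setup_prog = Set ''h'' (Read ''in'' (Lit 0)) ;; Set ''n'' (Read ''in'' (Lit 1)) ;; Set ''N'' (Lit 0) ;;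
     For ''a'' ''h'' (Write ''off'' (Var ''a'') (Var ''N'') ;;
       For ''b'' ''n'' (
         Write ''row'' (Var ''N'') (Var ''a'') ;;
         Write ''col'' (Var ''N'') (Var ''b'') ;;
         Write ''R'' (Var ''N'') (Minus (Read ''in'' (Plus (Lit 2) (Plus (Var ''N'') (Var ''N'')))) (Lit 1)) ;;
         Write ''T'' (Var ''N'') (Minus (Read ''in'' (Plus (Lit 3) (Plus (Var ''N'') (Var ''N'')))) (Lit 1)) ;;
         Write ''X'' (Var ''N'') (Var ''a'') ;;
         Write ''A'' (Var ''N'') (Var ''N'') ;;
         Inc ''N'')) ;;
     Write ''par'' (Lit 0) (Lit 0) ;;
     For ''a'' ''N'' (Write ''par'' (Plus (Var ''a'') (Lit 1)) (Minus (Lit 1) (Read ''par'' (Var ''a''))))"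

text \<open>Subtraction is truncated, so the larger of the two differences is the distance.\<close>

definition displacement_prog :: com where
  "displacement_prog = Set ''D'' (Lit 0) ;; For ''a'' ''N'' (
     If_then (Less (Var ''D'') (Minus (Read ''T'' (Var ''a'')) (Read ''col'' (Var ''a''))))
       (Set ''D'' (Minus (Read ''T'' (Var ''a'')) (Read ''col'' (Var ''a'')))) ;;
     If_then (Less (Var ''D'') (Minus (Read ''col'' (Var ''a'')) (Read ''T'' (Var ''a''))))
       (Set ''D'' (Minus (Read ''col'' (Var ''a'')) (Read ''T'' (Var ''a'')))))"

text \<open>Inverts \<open>X\<close> within each column: \<open>X\<close> gives the token of a
  colour, whereas sorting needs the colour of a token.\<close>

definition key_prog :: com where
  "key_prog = For ''a'' ''N'' (Write ''K''
     (Plus (Read ''off'' (Read ''X'' (Var ''a''))) (Read ''col'' (Var ''a''))) (Read ''row'' (Var ''a'')))"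

definition routing_prog :: com where
  "routing_prog = setup_prog ;; displacement_prog ;; rows_prog ;; key_prog ;;
     Cond (Equal (Var ''h'') (Lit 2)) (Set ''V'' (Lit 1)) (Set ''V'' (Var ''h'')) ;;
     phase_prog ''row'' ''K'' (Var ''n'') (Var ''h'') (Var ''V'') ;;
     phase_prog ''col'' ''T'' (Lit 1) (Var ''n'') (Plus (Var ''D'') (Var ''D'')) ;;
     phase_prog ''row'' ''R'' (Var ''n'') (Var ''h'') (Var ''V'')"

lemma writes_setup_prog [simp]: "writes setup_prog =
    {''h'', ''n'', ''N'', ''a'', ''b'', ''off'', ''row'', ''col'', ''R'', ''T'', ''X'', ''A'', ''par''}"
  by (auto simp: setup_prog_def)

lemma writes_displacement_prog [simp]: "writes displacement_prog = {''D'', ''a''}"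
  by (auto simp: displacement_prog_def)

lemma writes_key_prog [simp]: "writes key_prog = {''K'', ''a''}"
  by (auto simp: key_prog_def)

section \<open>Correctness of the preparation: tables, displacement and keys\<close>

context grid_prog
begin

definition init_cells :: "nat \<Rightarrow> state \<Rightarrow> bool" where
  "init_cells k s \<longleftrightarrow> s ''N'' 0 = k \<and> (\<forall>i<k. s ''row'' i = i div n \<and> s ''col'' i = i mod n \<and>
     s ''T'' i = T i \<and> s ''R'' i = R i \<and> s ''X'' i = i div n \<and> s ''A'' i = i)"

lemma init_cells_upd [simp]:
  "x \<notin> {''N'', ''row'', ''col'', ''T'', ''R'', ''X'', ''A''} \<Longrightarrow> init_cells k (s(x := f)) = init_cells k s"
  by (auto simp: init_cells_def)

lemma wp_setup_prog:
  assumes input: "s ''in'' 0 = h" "s ''in'' 1 = n"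
    "\<And>i. i < h * n \<Longrightarrow> s ''in'' (2 + 2 * i) = Suc (R i) \<and> s ''in'' (3 + 2 * i) = Suc (T i)"
  shows "wp B setup_prog (\<lambda>s'. base s' \<and> (\<forall>i<h * n. s' ''X'' i = i div n \<and> s' ''A'' i = i)) s"
  unfolding setup_prog_def
proof (intro wp_Seq wp_Write, rule wp_For[where I =
    "\<lambda>a s'. init_cells (a * n) s' \<and> (\<forall>r<a. s' ''off'' r = r * n)"], goal_cases)
  case (7 a s1)
  have fr1: "s1 ''h'' 0 = h" "s1 ''n'' 0 = n" "s1 ''in'' = s ''in''"
    using 7(4)[of "''h''"] 7(4)[of "''n''"] 7(4)[of "''in''"] input by simp_all
  have a: "a < h" using 7(2) input by simp
  show ?case
  proof (rule wp_Seq, rule wp_Write, rule wp_For[where I =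
      "\<lambda>b s'. init_cells (a * n + b) s' \<and> (\<forall>r<Suc a. s' ''off'' r = r * n)"], goal_cases)
    case 1
    then show ?case using 7(1,3) by (auto simp: init_cells_def less_Suc_eq)
  next
    case 2
    then show ?case using B fr1 by simp
  next
    case (7 b s2)
    have b: "b < n" using 7(2) fr1 by simp
    have v: "s2 ''in'' = s ''in''" "s2 ''a'' 0 = a"
      using fr1 \<open>s1 ''a'' 0 = a\<close> 7(4)[of "''in''"] 7(4)[of "''a''"] by simp_all
    define i where "i = a * n + b"
    have I: "init_cells i s2" "\<forall>r<Suc a. s2 ''off'' r = r * n" using 7(1) by (simp_all add: i_def)
    have Suc_i: "a * n + Suc b = Suc i" by (simp add: i_def)
    have N: "s2 ''N'' 0 = i" using I by (simp add: init_cells_def)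
    have inp: "s ''in'' (2 + (i + i)) = Suc (R i)" "s ''in'' (3 + (i + i)) = Suc (T i)"
      using input(3)[of i] cell_less[OF a b] by (simp_all only: mult_2 i_def)
    have dm: "i div n = a" "i mod n = b" using b by (simp_all add: i_def)
    show ?case unfolding Suc_i
      by (intro wp_Seq wp_Write)
        (use I inp in \<open>simp add: N 7(3) v init_cells_def less_Suc_eq all_conj_distrib dm\<close>)
  next
    case (8 s2)
    then show ?case using fr1 by (simp add: add.commute)
  qed auto
next
  case (8 s1)
  have fr1: "s1 ''h'' 0 = h" "s1 ''n'' 0 = n"
    using 8(2)[of "''h''"] 8(2)[of "''n''"] input by simp_all
  have I: "init_cells (h * n) s1" "\<forall>r<h. s1 ''off'' r = r * n" using 8(1) input by simp_all
  show ?case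
  proof (intro wp_Seq wp_Write, rule wp_For[where I = "\<lambda>k s'. \<forall>x\<le>k. s' ''par'' x = x mod 2"], goal_cases)
    case (7 k s2)
    have "1 - k mod 2 = Suc k mod 2" by presburger
    then show ?case by (intro wp_Write) (use 7(1,3) in \<open>auto simp: le_Suc_eq\<close>)
  next
    case (8 s2)
    have fr: "s2 y = s1 y" if "y \<notin> {''par'', ''a''}" for y using 8(2)[of y] that by simp
    show ?case using 8(1) I fr1 by (simp add: base_def fr init_cells_def)
  qed (use I B in \<open>simp_all add: init_cells_def\<close>)
qed (use input B in \<open>auto simp: init_cells_def\<close>)

text \<open>The maximum is characterised as least upper bound: the bound feeds the row phase, and
  leastness yields both \<open>D <= n\<close> and \<open>D <= OPT\<close>.\<close>

definition max_displacement :: "nat \<Rightarrow> nat \<Rightarrow> bool" where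
  "max_displacement k d \<longleftrightarrow> (\<forall>i<k. T i \<le> i mod n + d \<and> i mod n \<le> T i + d) \<and>
    (\<forall>e. (\<forall>i<k. T i \<le> i mod n + e \<and> i mod n \<le> T i + e) \<longrightarrow> d \<le> e)"

lemma max_displacement_Suc:
  assumes m: "max_displacement k d"
    and "d \<le> d'" "T k \<le> k mod n + d'" "k mod n \<le> T k + d'"
    and d': "d' = d \<or> d' = T k - k mod n \<or> d' = k mod n - T k"
  shows "max_displacement (Suc k) d'"
proof -
  have le: "T i \<le> i mod n + d' \<and> i mod n \<le> T i + d'" if "i < Suc k" for i
  proof (cases "i = k")
    case False
    then have "T i \<le> i mod n + d \<and> i mod n \<le> T i + d"
      using m that by (simp add: max_displacement_def)
    then show ?thesis using \<open>d \<le> d'\<close> by linarith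
  qed (use assms in simp)
  moreover have "d' \<le> e" if e: "\<forall>i<Suc k. T i \<le> i mod n + e \<and> i mod n \<le> T i + e" for e
  proof -
    have "d \<le> e" using m e by (simp add: max_displacement_def)
    then show ?thesis using d' e[rule_format, of k] by linarith
  qed
  ultimately show ?thesis by (simp add: max_displacement_def)
qed

lemma wp_displacement_prog:
  assumes b: "base s"
  shows "wp B displacement_prog (\<lambda>s'. max_displacement (h * n) (s' ''D'' 0)) s"
  unfolding displacement_prog_def
proof (rule wp_Seq, rule wp_Write, rule wp_For[where I = "\<lambda>k s'. max_displacement k (s' ''D'' 0)"], goal_cases)
  case (7 k s1)
  have k: "k < h * n" using 7(2) b by (simp add: base_def)
  have v: "s1 ''T'' k = T k" "s1 ''col'' k = k mod n"
    using 7(4)[of "''T''"] 7(4)[of "''col''"] b k by (simp_all add: base_def)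
  show ?case
    by (intro wp_intros) (rule max_displacement_Suc[OF 7(1)]; simp add: 7(3) v)+
next
  case (8 s')
  then show ?case using b by (simp add: base_def)
qed (use b B in \<open>simp_all add: base_def max_displacement_def\<close>)

text \<open>Guarantees that \<open>key_prog\<close> never overwrites a key already stored.\<close>

lemma columnwise_inj:
  assumes X: "columnwise X" and i: "i < h * n" "j < h * n"
    and eq: "X i * n + i mod n = X j * n + j mod n"
  shows "i = j"
proof -
  have n: "i mod n < n" "j mod n < n" using i mod_less_cols by blast+
  have m: "i mod n = j mod n" and x: "X i = X j" using eq n by (simp_all add: cell_eq_iff)
  have inj: "inj_on (\<lambda>r. X (r * n + i mod n)) {..<h}"
    using X n(1) unfolding columnwise_def bij_betw_def by blast
  have "X (i div n * n + i mod n) = X (j div n * n + i mod n)" using x m by (metis div_mult_mod_eq)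
  from inj_onD[OF inj this] have "i div n = j div n" using i div_less_rows by simp
  then show ?thesis using m by (metis div_mult_mod_eq)
qed

lemma columnwise_less:
  assumes "columnwise X" "i < h * n"
  shows "X i < h"
proof -
  have "bij_betw (\<lambda>r. X (r * n + i mod n)) {..<h} {..<h}"
    using assms mod_less_cols[of i h n] by (simp add: columnwise_def)
  from bij_betw_apply[OF this, of "i div n"] have "X (i div n * n + i mod n) < h"
    using div_less_rows[OF assms(2)] by simp
  then show ?thesis by simp
qed

lemma wp_key_prog:
  assumes b: "base s" and X: "columnwise (s ''X'')"
  shows "wp B key_prog (\<lambda>s'. \<forall>i<h * n. s' ''K'' (s ''X'' i * n + i mod n) = i div n) s"
  unfolding key_prog_def
proof (rule wp_For[where I = "\<lambda>k s'. \<forall>i<k. s' ''K'' (s ''X'' i * n + i mod n) = i div n"], goal_cases)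
  case (7 k s1)
  have k: "k < h * n" using 7(2) b by (simp add: base_def)
  have "s ''X'' k < h" by (rule columnwise_less[OF X k])
  then have v: "s1 ''off'' (s1 ''X'' k) + s1 ''col'' k = s ''X'' k * n + k mod n" "s1 ''row'' k = k div n"
    using 7(4)[of "''off''"] 7(4)[of "''X''"] 7(4)[of "''col''"] 7(4)[of "''row''"] b k
    by (simp_all add: base_def)
  have "s ''X'' i * n + i mod n \<noteq> s ''X'' k * n + k mod n" if "i < k" for i
    using columnwise_inj[OF X, of i k] that k by auto
  then show ?case
    by (intro wp_Write) (use 7(1) in \<open>simp add: 7(3) v less_Suc_eq\<close>)
next
  case (8 s')
  then show ?case using b by (simp add: base_def)
qed (use b B in \<open>simp_all add: base_def\<close>)

end

section \<open>The complete algorithm\<close>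

context grid_prog
begin

text \<open>\<open>key\<close>, \<open>kT\<close>, \<open>kR\<close> and \<open>A\<close> stand for
  program arrays, whose contents are known on the cells of the grid only.\<close>

lemma three_phases:
  fixes key kT kR A :: "nat \<Rightarrow> nat" and D W :: nat
  defines "A1 \<equiv> grid_lines.arrangement h n h n (\<lambda>i. i div n) key A W"
  defines "A2 \<equiv> grid_lines.arrangement h n n 1 (\<lambda>i. i mod n) kT A1 (2 * D)"
  defines "A3 \<equiv> grid_lines.arrangement h n h n (\<lambda>i. i div n) kR A2 W"
  assumes n: "0 < n" and W: "W = (if h = 2 then 1 else h)"
    and R: "\<And>i. i < h * n \<Longrightarrow> R i < h"
    and RT: "\<And>i j. i < h * n \<Longrightarrow> j < h * n \<Longrightarrow> R i = R j \<Longrightarrow> T i = T j \<Longrightarrow> i = j"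
    and X: "columnwise X" and dist: "\<And>r. r < h \<Longrightarrow> inj_on (target X r) {..<n}"
    and key: "\<And>i. i < h * n \<Longrightarrow> key (X i * n + i mod n) = i div n"
    and kT: "\<And>i. i < h * n \<Longrightarrow> kT i = T i" and kR: "\<And>i. i < h * n \<Longrightarrow> kR i = R i"
    and A: "\<And>i. i < h * n \<Longrightarrow> A i = i"
    and D: "max_displacement (h * n) D"
    and i: "i < h * n"
  shows "A3 i < h * n \<and> R (A3 i) = i div n \<and> T (A3 i) = i mod n"
proof -
  interpret v: grid_lines h n n h n "\<lambda>i. i div n" "\<lambda>i. i mod n" "\<lambda>a q. q * n + a"
    by (rule grid_lines_vertical[OF n])
  interpret w: grid_lines h n h n 1 "\<lambda>i. i mod n" "\<lambda>i. i div n" "\<lambda>a q. a * n + q"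
    by (rule grid_lines_horizontal[OF n])
  have A_inj: "inj_on A {..<h * n}" "\<forall>i<h * n. A i < h * n" using A by (auto simp: inj_on_def)
  have A1: "inj_on A1 {..<h * n}" "\<forall>i<h * n. A1 i < h * n"
    using v.arrangement_line_inj[OF A_inj, of key W] by (simp_all add: A1_def)
  have A2: "inj_on A2 {..<h * n}" "\<forall>i<h * n. A2 i < h * n"
    using w.arrangement_line_inj[OF A1, of kT "2 * D"] by (simp_all add: A2_def)
  have A3: "inj_on A3 {..<h * n}" "\<forall>i<h * n. A3 i < h * n"
    using v.arrangement_line_inj[OF A2, of kR W] by (simp_all add: A3_def)

  \<comment> \<open>Seen as a token, every cell has a colour \<open>r\<close>, and its key is that
    colour.\<close>
  have row: "\<exists>r<h. i = X (r * n + i mod n) * n + i mod n \<and> key i = r" if i: "i < h * n" for i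
  proof -
    have c: "i mod n < n" and r: "i div n < h" using mod_less_cols[OF i] div_less_rows[OF i] by auto
    have "(\<lambda>r. X (r * n + i mod n)) ` {..<h} = {..<h}"
      using X c unfolding columnwise_def bij_betw_def by blast
    then have "i div n \<in> (\<lambda>r. X (r * n + i mod n)) ` {..<h}" using r by simp
    then obtain q where q: "q < h" "X (q * n + i mod n) = i div n" by auto
    then have "i = X (q * n + i mod n) * n + i mod n" by simp
    moreover have "key (X (q * n + i mod n) * n + i mod n) = q"
      using key[OF cell_less[OF q(1) c]] c by simp
    ultimately show ?thesis using q(1) by metis
  qed
  have key_less: "key i < h" if "i < h * n" for i using row[OF that] by auto
  have key1: "key (A1 i) = i div n" if i: "i < h * n" for i
    unfolding A1_def
  proof (rule v.arrangement_sorted[OF _ _ _ i])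
    fix a assume a: "a < n"
    show "inj_on (\<lambda>q. key (A (q * n + a))) {..<h}"
    proof (rule inj_onI)
      fix q q' assume q: "q \<in> {..<h}" "q' \<in> {..<h}" "key (A (q * n + a)) = key (A (q' * n + a))"
      then have c: "q * n + a < h * n" "q' * n + a < h * n" using a cell_less by auto
      then have eq: "key (q * n + a) = key (q' * n + a)" using q(3) A by simp
      have "q * n + a = q' * n + a" using row[OF c(1)] row[OF c(2)] eq a by auto
      then show "q = q'" using a by simp
    qed
  qed (use key_less A W in auto)
  have col1: "A1 i mod n = i mod n" if i: "i < h * n" for i
    using v.arrangement_line[OF i, of key A W] A by (auto simp: A1_def)
  \<comment> \<open>Sorting by colour has put the token of colour \<open>r\<close> into row
    \<open>r\<close>, so the targets in that row are distinct by \<open>dist\<close>.\<close>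
  have T1: "T (A1 i) = target X (i div n) (i mod n)" if i: "i < h * n" for i
    using row[of "A1 i"] A1(2) key1[OF i] col1[OF i] i unfolding target_def by metis
  have "kT (A2 i) = i mod n" if i: "i < h * n" for i
    unfolding A2_def
  proof (rule w.arrangement_sorted[OF _ _ _ i])
    fix a assume a: "a < h"
    have "kT (A1 (a * n + q)) = target X a q" if "q < n" for q
      using T1[OF cell_less[OF a that]] that A1(2) cell_less[OF a that] by (simp add: kT)
    then show "inj_on (\<lambda>q. kT (A1 (a * n + q))) {..<n}"
      using dist[OF a] by (simp add: inj_on_def)
  next
    \<comment> \<open>The first phase left every token in its column, so the displacement bound of
      the input still applies.\<close>
    have "i mod n \<le> kT (A1 i) + D \<and> kT (A1 i) \<le> i mod n + D" if "i < h * n" for i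
      using D A1(2) col1[OF that] kT that unfolding max_displacement_def by metis
    then show "2 * D = n \<or> 2 * D = 1 \<and> n = 2 \<or>
      (\<exists>d. 2 * D = 2 * d \<and> (\<forall>i<h * n. i mod n \<le> kT (A1 i) + d \<and> kT (A1 i) \<le> i mod n + d))"
      by blast
  qed (use T_less A1 kT in auto)
  then have T2: "T (A2 i) = i mod n" if "i < h * n" for i
    using that A2(2) kT by simp
  have "kR (A3 i) = i div n"
    unfolding A3_def
  proof (rule v.arrangement_sorted[OF _ _ _ i])
    fix a assume a: "a < n"
    show "inj_on (\<lambda>q. kR (A2 (q * n + a))) {..<h}"
    proof (rule inj_onI)
      fix q q' assume q: "q \<in> {..<h}" "q' \<in> {..<h}" "kR (A2 (q * n + a)) = kR (A2 (q' * n + a))"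
      then have c: "q * n + a < h * n" "q' * n + a < h * n" using a cell_less by auto
      then have r: "R (A2 (q * n + a)) = R (A2 (q' * n + a))" using q(3) A2(2) kR by simp
      \<comment> \<open>After the row phase all tokens of column \<open>a\<close> have target column
        \<open>a\<close>; equal target rows would make two of them the same token.\<close>
      have "T (A2 (q * n + a)) = T (A2 (q' * n + a))" using T2[OF c(1)] T2[OF c(2)] a by simp
      then have "A2 (q * n + a) = A2 (q' * n + a)" using RT[OF _ _ r] A2(2) c by blast
      then have "q * n + a = q' * n + a" using A2(1) c by (auto dest: inj_onD)
      then show "q = q'" using a by simp
    qed
  qed (use R A2 W kR in auto)
  then have R3: "R (A3 i) = i div n" using A3(2) i kR by simp
  obtain j where j: "j < h * n" "j mod n = i mod n" "A3 i = A2 j"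
    using v.arrangement_line[OF i, of kR A2 W] by (auto simp: A3_def)
  have "T (A3 i) = i mod n" unfolding j(3) T2[OF j(1)] by (rule j(2))
  then show ?thesis using R3 A3(2) i by blast
qed

text \<open>The targets of the tokens run through all cells exactly once, so each column is the
  target of \<open>h\<close> tokens.\<close>

lemma regular:
  assumes R: "\<And>i. i < h * n \<Longrightarrow> R i < h"
    and RT: "\<And>i j. i < h * n \<Longrightarrow> j < h * n \<Longrightarrow> R i = R j \<Longrightarrow> T i = T j \<Longrightarrow> i = j"
    and v: "v < n"
  shows "(\<Sum>c<n. \<Sum>x<h. of_bool (T (x * n + c) = v)) = h"
proof -
  let ?f = "\<lambda>(c, x). (T (x * n + c), R (x * n + c))"
  have inj: "inj_on ?f ({..<n} \<times> {..<h})"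
  proof (rule inj_onI)
    fix p p' assume p: "p \<in> {..<n} \<times> {..<h}" "p' \<in> {..<n} \<times> {..<h}" "?f p = ?f p'"
    obtain c x c' x' where pp: "p = (c, x)" "p' = (c', x')" by (cases p, cases p')
    have "x * n + c = x' * n + c'" using p RT[OF cell_less cell_less, of x c x' c'] unfolding pp by simp
    then show "p = p'" using p unfolding pp by (simp add: cell_eq_iff)
  qed
  have "?f ` ({..<n} \<times> {..<h}) \<subseteq> {..<n} \<times> {..<h}"
    using R T_less cell_less by auto
  then have "?f ` ({..<n} \<times> {..<h}) = {..<n} \<times> {..<h}"
    using card_image[OF inj] by (intro card_subset_eq) auto
  then have bij: "bij_betw ?f ({..<n} \<times> {..<h}) ({..<n} \<times> {..<h})"
    using inj by (simp add: bij_betw_def)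
  have "(\<Sum>c<n. \<Sum>x<h. of_bool (T (x * n + c) = v)) =
      (\<Sum>p\<in>{..<n} \<times> {..<h}. of_bool (fst (?f p) = v))"
    by (simp add: sum.cartesian_product case_prod_unfold)
  also have "\<dots> = (\<Sum>p\<in>{..<n} \<times> {..<h}. of_bool (fst p = v))"
    by (rule sum.reindex_bij_betw[OF bij])
  also have "\<dots> = (\<Sum>c<n. \<Sum>x<h. of_bool (c = v))"
    by (simp add: sum.cartesian_product case_prod_unfold)
  also have "\<dots> = h" using v by (simp add: sum.delta of_bool_def if_distrib cong: if_cong)
  finally show ?thesis .
qed

end

lemma wp_routing_prog:
  assumes h: "2 \<le> h" and n: "2 \<le> n" and C: "configuration (grid h n) C"
  defines "xs \<equiv> encode_instance h n C"
  shows "wp ((length xs)^3) routing_prog (\<lambda>s. \<exists>Ms. output_of s = encode_solution h n Ms \<and>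
    solution (grid h n) C Ms \<and>
    length Ms \<le> 2 * OPT (grid h n) C + 2 * (if h = 2 then 1 else h)) (input_state xs)"
proof -
  let ?B = "(length xs)^3"
  let ?s0 = "input_state xs"
  define R where "R i = fst (C (vertex n i)) - 1" for i
  define T where "T i = snd (C (vertex n i)) - 1" for i
  define W where "W = (if h = 2 then 1 else h)"
  have n0: "0 < n" using n by simp
  have Cv: "C (vertex n i) = (Suc (R i), Suc (T i)) \<and> R i < h \<and> T i < n" if "i < h * n" for i
  proof -
    have "C (vertex n i) \<in> verts (grid h n)"
      using C vertex_grid[OF that] unfolding configuration_def by (rule bij_betw_apply)
    then show ?thesis by (auto simp: R_def T_def grid_def)
  qed
  have RT: "i = j" if "i < h * n" "j < h * n" "R i = R j" "T i = T j" for i j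
  proof -
    have "inj_on C (verts (grid h n))" using C by (simp add: configuration_def bij_betw_def)
    moreover have "C (vertex n i) = C (vertex n j)" using Cv that by simp
    ultimately have "vertex n i = vertex n j" using vertex_grid that by (blast dest: inj_onD)
    then show ?thesis by (simp add: vertex_inj)
  qed
  have len: "length xs = 2 + 2 * (h * n)"
    by (simp add: xs_def encode_instance_def encode_map_cells length_concat_pairs)
  have hn: "h \<le> h * n" "n \<le> h * n" "2 * n \<le> h * n" using h n by simp_all
  have B_le: "h * n \<le> ?B" "(h * n) * (n * n) + 1 \<le> ?B"
  proof -
    \<comment> \<open>The number of passes is of third order in the number of cells, which is why
      the cube of the input length is chosen.\<close>
    have "(h * n) * (n * n) \<le> (h * n) * ((h * n) * (h * n))" using hn by (intro mult_mono) auto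
    also have "\<dots> + 1 \<le> (h * n + 1)^3" by (simp add: power3_eq_cube algebra_simps)
    also have "(h * n + 1)^3 \<le> ?B" unfolding len by (rule power_mono) simp_all
    finally show "(h * n) * (n * n) + 1 \<le> ?B" by simp
    have "h * n \<le> length xs" by (simp add: len)
    also have "\<dots> \<le> ?B" using len by (intro self_le_power) simp_all
    finally show "h * n \<le> ?B" .
  qed
  have hn_le: "h \<le> ?B" "n \<le> ?B" using order_trans[OF hn(1) B_le(1)] order_trans[OF hn(2) B_le(1)] .
  interpret grid_prog h n T R ?B
    by unfold_locales (use Cv B_le hn_le in auto)

  have inp: "?s0 ''in'' 0 = h" "?s0 ''in'' 1 = n"
    "\<And>i. i < h * n \<Longrightarrow> ?s0 ''in'' (2 + 2 * i) = Suc (R i) \<and> ?s0 ''in'' (3 + 2 * i) = Suc (T i)"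
  proof -
    have xs: "xs = h # n # encode_map h n C" by (simp add: xs_def encode_instance_def)
    show "?s0 ''in'' 0 = h" "?s0 ''in'' 1 = n" using xs by (simp_all add: input_state_def)
    fix i assume i: "i < h * n"
    have "encode_map h n C ! (2 * i) = Suc (R i)" "encode_map h n C ! Suc (2 * i) = Suc (T i)"
      unfolding encode_map_cells
      using nth_concat_pairs[OF i, of "\<lambda>i. fst (C (vertex n i))" "\<lambda>i. snd (C (vertex n i))"] Cv[OF i]
      by simp_all
    then show "?s0 ''in'' (2 + 2 * i) = Suc (R i) \<and> ?s0 ''in'' (3 + 2 * i) = Suc (T i)"
      using i len by (simp add: input_state_def xs numeral_2_eq_2 numeral_3_eq_3)
  qed
  have out0: "output_of ?s0 = []" by (simp add: output_of_def input_state_def)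
  let ?post = "\<lambda>s. \<exists>Ms. output_of s = encode_solution h n Ms \<and> solution (grid h n) C Ms \<and>
    length Ms \<le> 2 * OPT (grid h n) C + 2 * W"
  have "wp ?B routing_prog ?post ?s0"
    unfolding routing_prog_def
  proof (rule wp_SeqI[OF wp_setup_prog[where s = ?s0, OF inp]])
    fix s1
    assume s1: "base s1 \<and> (\<forall>i<h * n. s1 ''X'' i = i div n \<and> s1 ''A'' i = i)"
      and fr1: "\<And>x. x \<notin> writes setup_prog \<Longrightarrow> s1 x = ?s0 x"
    have out1: "output_of s1 = []" using output_of_cong[of s1 ?s0] fr1 out0 by simp
    have cw1: "columnwise (s1 ''X'')" unfolding columnwise_def
    proof (intro allI impI)
      fix c assume c: "c < n"
      have "s1 ''X'' (r * n + c) = r" if "r < h" for r using s1 cell_less[OF that c] c by simp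
      then show "bij_betw (\<lambda>r. s1 ''X'' (r * n + c)) {..<h} {..<h}"
        by (subst bij_betw_cong[where g = id]) auto
    qed
    show "wp ?B (displacement_prog ;; rows_prog ;; key_prog ;;
       Cond (Equal (Var ''h'') (Lit 2)) (Set ''V'' (Lit 1)) (Set ''V'' (Var ''h'')) ;;
       phase_prog ''row'' ''K'' (Var ''n'') (Var ''h'') (Var ''V'') ;;
       phase_prog ''col'' ''T'' (Lit 1) (Var ''n'') (Plus (Var ''D'') (Var ''D'')) ;;
       phase_prog ''row'' ''R'' (Var ''n'') (Var ''h'') (Var ''V'')) ?post s1"
    proof (rule wp_SeqI[OF wp_displacement_prog[OF conjunct1[OF s1]]])
      fix s2
      assume D: "max_displacement (h * n) (s2 ''D'' 0)"
        and fr2: "\<And>x. x \<notin> writes displacement_prog \<Longrightarrow> s2 x = s1 x"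
      define D where "D = s2 ''D'' 0"
      have b2: "base s2" by (rule base_cong[OF conjunct1[OF s1]]) (simp_all add: fr2)
      have cw2: "columnwise (s2 ''X'')" using cw1 fr2 by simp
      show "wp ?B (rows_prog ;; key_prog ;;
         Cond (Equal (Var ''h'') (Lit 2)) (Set ''V'' (Lit 1)) (Set ''V'' (Var ''h'')) ;;
         phase_prog ''row'' ''K'' (Var ''n'') (Var ''h'') (Var ''V'') ;;
         phase_prog ''col'' ''T'' (Lit 1) (Var ''n'') (Plus (Var ''D'') (Var ''D'')) ;;
         phase_prog ''row'' ''R'' (Var ''n'') (Var ''h'') (Var ''V'')) ?post s2"
      proof (rule wp_SeqI[OF wp_rows_prog[OF b2 cw2]])
        fix s3
        assume s3: "columnwise (s3 ''X'') \<and> balanced (s3 ''X'') ({..<h} \<times> {..<h} \<times> {..<n})"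
          and fr3: "\<And>x. x \<notin> writes rows_prog \<Longrightarrow> s3 x = s2 x"
        have b3: "base s3" by (rule base_cong[OF b2]) (simp_all add: fr3)
        have dist: "inj_on (target (s3 ''X'') r) {..<n}" if "r < h" for r
          by (rule balanced_imp_distinct[OF conjunct1[OF s3] regular _ that])
            (use Cv RT s3 in \<open>auto simp: balanced_def\<close>)
        show "wp ?B (key_prog ;;
           Cond (Equal (Var ''h'') (Lit 2)) (Set ''V'' (Lit 1)) (Set ''V'' (Var ''h'')) ;;
           phase_prog ''row'' ''K'' (Var ''n'') (Var ''h'') (Var ''V'') ;;
           phase_prog ''col'' ''T'' (Lit 1) (Var ''n'') (Plus (Var ''D'') (Var ''D'')) ;;
           phase_prog ''row'' ''R'' (Var ''n'') (Var ''h'') (Var ''V'')) ?post s3"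
        proof (rule wp_SeqI[OF wp_key_prog[OF b3 conjunct1[OF s3]]])
          fix s4
          assume key: "\<forall>i<h * n. s4 ''K'' (s3 ''X'' i * n + i mod n) = i div n"
            and fr4: "\<And>x. x \<notin> writes key_prog \<Longrightarrow> s4 x = s3 x"
          \<comment> \<open>Both branches of the conditional on \<open>h\<close> lead to this one
            state.\<close>
          define s5 where "s5 = s4(''V'' := (s4 ''V'')(0 := W))"
          have b4: "base s4" by (rule base_cong[OF b3]) (simp_all add: fr4)
          have b5: "base s5" by (rule base_cong[OF b4]) (simp_all add: s5_def)
          have v5: "s5 ''K'' = s4 ''K''" "s5 ''A'' = s1 ''A''" "s5 ''D'' 0 = D" "s5 ''V'' 0 = W"
            by (simp_all add: s5_def D_def fr4 fr3 fr2)
          have "output_of s5 = output_of s1" by (rule output_of_cong) (simp_all add: s5_def fr4 fr3 fr2)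
          then have em5: "emitted h n C 0 (s5 ''A'') (output_of s5)"
            using emitted_Nil[of h n "s5 ''A''" C] s1 v5 out1 by simp
          note vert = grid_lines_vertical[OF n0, of h] and hor = grid_lines_horizontal[OF n0, of h]
          let ?A1 = "grid_lines.arrangement h n h n (\<lambda>i. i div n) (s4 ''K'') (s1 ''A'') W"
          let ?A2 = "grid_lines.arrangement h n n 1 (\<lambda>i. i mod n) (s4 ''T'') ?A1 (2 * D)"
          let ?A3 = "grid_lines.arrangement h n h n (\<lambda>i. i div n) (s4 ''R'') ?A2 W"
          have W_le: "W \<le> ?B" using hn_le(1) h by (simp add: W_def)
          have "D \<le> n"
          proof -
            have "\<forall>i<h * n. T i \<le> i mod n + n \<and> i mod n \<le> T i + n"
              using Cv mod_less_cols by (simp add: less_imp_le trans_le_add2)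
            then show ?thesis using D unfolding D_def max_displacement_def by blast
          qed
          \<comment> \<open>\<open>2 * D <= 2 * n <= h * n\<close>, the last step because
            \<open>h\<close> is at least 2.\<close>
          then have D_le: "2 * D \<le> ?B" using B_le(1) hn(3) by linarith
          interpret p1: grid_phase h n T R ?B n h n "\<lambda>i. i div n" "\<lambda>i. i mod n" "\<lambda>a q. q * n + a"
            "''row''" "''K''" "s4 ''K''" C
            using vert grid_prog_axioms hn by (intro grid_phase.intro grid_phase_axioms.intro) simp_all
          interpret p2: grid_phase h n T R ?B h n 1 "\<lambda>i. i mod n" "\<lambda>i. i div n" "\<lambda>a q. a * n + q"
            "''col''" "''T''" "s4 ''T''" C
            using hor grid_prog_axioms hn by (intro grid_phase.intro grid_phase_axioms.intro) simp_all
          interpret p3: grid_phase h n T R ?B n h n "\<lambda>i. i div n" "\<lambda>i. i mod n" "\<lambda>a q. q * n + a"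
            "''row''" "''R''" "s4 ''R''" C
            using vert grid_prog_axioms hn by (intro grid_phase.intro grid_phase_axioms.intro) simp_all
          have phases: "wp ?B (phase_prog ''row'' ''K'' (Var ''n'') (Var ''h'') (Var ''V'') ;;
             phase_prog ''col'' ''T'' (Lit 1) (Var ''n'') (Plus (Var ''D'') (Var ''D'')) ;;
             phase_prog ''row'' ''R'' (Var ''n'') (Var ''h'') (Var ''V''))
             (\<lambda>s. s ''A'' = ?A3 \<and> emitted h n C (0 + W + 2 * D + W) (s ''A'') (output_of s)) s5"
          proof (rule wp_SeqI[OF p1.wp_phase_prog[OF b5 _ _ _ W_le em5]], goal_cases)
            case 1
            then show ?case using b5 by (simp add: base_def)
          next
            case 2
            then show ?case by (rule v5(1))
          next
            case (3 s')
            then show ?case using v5(4) by (simp add: base_def)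
          next
            case (4 s6)
            have fr6: "s6 x = s5 x" if "x \<notin> writes (phase_prog ''row'' ''K'' (Var ''n'') (Var ''h'') (Var ''V''))"
              for x using 4(2) that .
            have A6: "s6 ''A'' = ?A1" using 4(1) v5(2) by simp
            have em6: "emitted h n C (0 + W) (s6 ''A'') (output_of s6)" using 4(1) by blast
            have b6: "base s6" by (rule base_cong[OF b5]) (simp_all add: fr6)
            show ?case
            proof (rule wp_SeqI[OF p2.wp_phase_prog[OF b6 _ _ _ D_le em6]], goal_cases)
              case 1
              then show ?case using b6 by (simp add: base_def)
            next
              case 2
              then show ?case by (simp add: fr6 s5_def)
            next
              case (3 s')
              then show ?case using v5(3) by (simp add: base_def fr6)
            next
              case (4 s7)
              have fr7: "s7 x = s6 x" if "x \<notin> writes (phase_prog ''col'' ''T'' (Lit 1) (Var ''n'') (Plus (Var ''D'') (Var ''D'')))"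
                for x using 4(2) that .
              have A7: "s7 ''A'' = ?A2" using 4(1) A6 by simp
              have em7: "emitted h n C (0 + W + 2 * D) (s7 ''A'') (output_of s7)" using 4(1) by blast
              have b7: "base s7" by (rule base_cong[OF b6]) (simp_all add: fr7)
              show ?case
              proof (rule wp_frame[OF p3.wp_phase_prog[OF b7 _ _ _ W_le em7]], goal_cases)
                case 1
                then show ?case using b7 by (simp add: base_def)
              next
                case 2
                then show ?case by (simp add: fr6 fr7 s5_def)
              next
                case (3 s')
                then show ?case using v5(4) by (simp add: base_def fr6 fr7)
              next
                case (4 s8)
                then show ?case unfolding A7 by blast
              qed
            qed
          qed
          have A3: "?A3 i < h * n \<and> R (?A3 i) = i div n \<and> T (?A3 i) = i mod n" if "i < h * n" for i
          proof (rule three_phases[OF n0 W_def _ RT conjunct1[OF s3] dist, of "s4 ''K''" "s4 ''T''" "s4 ''R''"])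
            show "max_displacement (h * n) D" using D by (simp add: D_def)
          qed (use Cv key b4 s1 that in \<open>simp_all add: base_def\<close>)
          have post: "?post s" if s: "s ''A'' = ?A3 \<and> emitted h n C (0 + W + 2 * D + W) (s ''A'') (output_of s)" for s
          proof -
            obtain Ms where Ms: "output_of s = encode_solution h n Ms" "\<forall>M\<in>set Ms. matching (grid h n) M"
              "length Ms = W + 2 * D + W"
              "\<forall>i<h * n. fold apply_matching Ms C (vertex n i) = C (vertex n (?A3 i))"
              using s unfolding emitted_def by auto
            have "C (vertex n (?A3 i)) = vertex n i" if "i < h * n" for i
              using A3[OF that] Cv[of "?A3 i"] by (simp add: vertex_def)
            then have sol: "solution (grid h n) C Ms"
              using Ms unfolding solution_def verts_grid by auto
            \<comment> \<open>The optimum is itself a common bound for all column displacements, so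
              leastness of \<open>D\<close> applies.\<close>
            have "\<forall>i<h * n. T i \<le> i mod n + OPT (grid h n) C \<and> i mod n \<le> T i + OPT (grid h n) C"
              using displacement_le_OPT[OF sol C vertex_grid] Cv by (fastforce simp: vertex_def)
            then have "D \<le> OPT (grid h n) C" using D unfolding D_def max_displacement_def by blast
            then show ?thesis using Ms(1,3) sol by (intro exI[of _ Ms]) simp
          qed
          have h4: "s4 ''h'' 0 = h" using b4 by (simp add: base_def)
          show "wp ?B (Cond (Equal (Var ''h'') (Lit 2)) (Set ''V'' (Lit 1)) (Set ''V'' (Var ''h'')) ;;
             phase_prog ''row'' ''K'' (Var ''n'') (Var ''h'') (Var ''V'') ;;
             phase_prog ''col'' ''T'' (Lit 1) (Var ''n'') (Plus (Var ''D'') (Var ''D'')) ;;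
             phase_prog ''row'' ''R'' (Var ''n'') (Var ''h'') (Var ''V'')) ?post s4"
          proof (rule wp_SeqI[where P = "\<lambda>s. s = s5"])
            show "wp ?B (Cond (Equal (Var ''h'') (Lit 2)) (Set ''V'' (Lit 1)) (Set ''V'' (Var ''h''))) (\<lambda>s. s = s5) s4"
              by (intro wp_intros) (simp_all add: s5_def h4 W_def)
          next
            fix s assume s: "s = s5"
            show "wp ?B (phase_prog ''row'' ''K'' (Var ''n'') (Var ''h'') (Var ''V'') ;;
              phase_prog ''col'' ''T'' (Lit 1) (Var ''n'') (Plus (Var ''D'') (Var ''D'')) ;;
              phase_prog ''row'' ''R'' (Var ''n'') (Var ''h'') (Var ''V'')) ?post s"
              unfolding s by (rule wp_frame[OF phases]) (rule post)
          qed
        qed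
      qed
    qed
  qed
  then show ?thesis by (simp add: W_def)
qed


theorem theorem4:
  shows
    "(\<exists>A. poly_time_on
            {encode_instance 2 n C | n C. 2 \<le> n \<and> configuration (grid 2 n) C} A \<and>
          (\<forall>n C. 2 \<le> n \<longrightarrow> configuration (grid 2 n) C \<longrightarrow>
             (\<exists>Ms. outputs A (encode_instance 2 n C) (encode_solution 2 n Ms) \<and>
                   solution (grid 2 n) C Ms \<and>
                   length Ms \<le> 2 * OPT (grid 2 n) C + 2)))
     \<and>
     (\<exists>A. poly_time_on
            {encode_instance h n C | h n C. 3 \<le> h \<and> h \<le> n \<and> configuration (grid h n) C} A \<and>
          (\<forall>h n C. 3 \<le> h \<longrightarrow> h \<le> n \<longrightarrow> configuration (grid h n) C \<longrightarrow>
             (\<exists>Ms. outputs A (encode_instance h n C) (encode_solution h n Ms) \<and>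
                   solution (grid h n) C Ms \<and>
                   length Ms \<le> 2 * OPT (grid h n) C + 2 * h)))"
proof -
  have time: "poly_time_on X routing_prog"
    if X: "\<And>xs. xs \<in> X \<Longrightarrow>
      \<exists>h n C. xs = encode_instance h n C \<and> 2 \<le> h \<and> 2 \<le> n \<and> configuration (grid h n) C" for X
  proof -
    \<comment> \<open>\<open>monom 1 3\<close> evaluates to the cube of the input length, the
      iteration bound under which the program was verified.\<close>
    obtain p :: "nat poly" where p: "\<forall>l. time_bound (poly (monom 1 3) l) routing_prog = poly p l"
      using time_bound_poly by blast
    have "\<exists>t s. exec routing_prog (input_state xs) t s \<and> t \<le> poly p (length xs)" if xs: "xs \<in> X" for xs
    proof -
      obtain h n C where C: "xs = encode_instance h n C" "2 \<le> h" "2 \<le> n" "configuration (grid h n) C"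
        using X[OF xs] by blast
      have "time_bound ((length xs)^3) routing_prog = poly p (length xs)"
        using p[rule_format, of "length xs"] by (simp add: poly_monom)
      then show ?thesis using wp_routing_prog[OF C(2-4)] unfolding wp_def C(1)[symmetric] by metis
    qed
    then show ?thesis unfolding poly_time_on_def by blast
  qed
  have correct: "\<exists>Ms. outputs routing_prog (encode_instance h n C) (encode_solution h n Ms) \<and>
      solution (grid h n) C Ms \<and> length Ms \<le> 2 * OPT (grid h n) C + 2 * (if h = 2 then 1 else h)"
    if "2 \<le> h" "2 \<le> n" "configuration (grid h n) C" for h n C
    using wp_routing_prog[OF that] unfolding wp_def outputs_def by metis
  show ?thesis
  proof (intro conjI exI[of _ routing_prog] allI impI)
    show "poly_time_on {encode_instance 2 n C | n C. 2 \<le> n \<and> configuration (grid 2 n) C} routing_prog"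
      by (rule time) blast
    show "poly_time_on {encode_instance h n C | h n C. 3 \<le> h \<and> h \<le> n \<and> configuration (grid h n) C} routing_prog"
    proof (rule time)
      fix xs
      assume "xs \<in> {encode_instance h n C | h n C. 3 \<le> h \<and> h \<le> n \<and> configuration (grid h n) C}"
      then obtain h n C where "xs = encode_instance h n C" "3 \<le> h" "h \<le> n" "configuration (grid h n) C"
        by blast
      then show "\<exists>h n C. xs = encode_instance h n C \<and> 2 \<le> h \<and> 2 \<le> n \<and> configuration (grid h n) C"
        by (intro exI[of _ h] exI[of _ n] exI[of _ C]) simp
    qed
  next
    fix n :: nat and C
    assume "2 \<le> n" "configuration (grid 2 n) C"
    from correct[OF order_refl this]
    show "\<exists>Ms. outputs routing_prog (encode_instance 2 n C) (encode_solution 2 n Ms) \<and>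
      solution (grid 2 n) C Ms \<and> length Ms \<le> 2 * OPT (grid 2 n) C + 2" by simp
  next
    fix h n :: nat and C
    assume h: "3 \<le> h" and n: "h \<le> n" and C: "configuration (grid h n) C"
    have "2 \<le> h" "2 \<le> n" using h n by simp_all
    from correct[OF this C] h
    show "\<exists>Ms. outputs routing_prog (encode_instance h n C) (encode_solution h n Ms) \<and>
      solution (grid h n) C Ms \<and> length Ms \<le> 2 * OPT (grid h n) C + 2 * h" by simp
  qed
qed

end
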